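(* Let $f,g_1,\dots,g_n\colon\mathbb{R}^d\to\mathbb{R}$ be convex, and consider the problem $\min_{\mathbf{x}\in\mathbb{R}^d} f(\mathbf{x})$ subject to $g_i(\mathbf{x})\le 0$, $i=1,\dots,n$, with Lagrangian $\mathcal{L}(\mathbf{x},\mathbf{y})=f(\mathbf{x})+\sum_{i=1}^n y_i g_i(\mathbf{x})$ on $Z=\mathbb{R}^d\times\mathbb{R}^n_+$. Assume there exists a primal-dual solution pair $(\mathbf{x}^\star,\mathbf{y}^\star)$ (a saddle point of $\mathcal{L}$ on $Z$). Let the stochastic oracles $\widetilde{\nabla}f,\widetilde{\nabla}g_i,\widetilde{g_i}$ and the operators $\widetilde{F}$, $F$ be as defined in the context, with $\mathbb{E}\|\widetilde{F}(\mathbf{z})\|^2\le B^2\|\mathbf{z}-\mathbf{z}_0\|^2+G^2$ for all $\mathbf{z}\in Z$, where $B>0$, $G\ge 0$ are finite. Let $\mathbf{z}_0=(\mathbf{x}_0,\mathbf{y}_0)\in Z$ and let $\mathbf{z}_k=(\mathbf{x}_k,\mathbf{y}_k)$ be generated for $k\ge 0$ by $$\mathbf{z}_{k+1}=P_Z\big(\beta_k\mathbf{z}_0+(1-\beta_k)\mathbf{z}_k-\tau_k\widetilde{F}(\mathbf{z}_k)\big),\qquad \beta_k=\frac{1}{k+2},\quad\tau_k=\frac{1}{5B\sqrt{k+2}}.$$ Then for every $k\ge 1$, with $\mathbf{x}_k^{\mathsf{out}}:=\frac{1}{\sum_{i=0}^{k-1}\tau_i}\sum_{i=0}^{k-1}\tau_i\mathbf{x}_i$,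 we have $$\mathbb{E}|f(\mathbf{x}_k^{\mathsf{out}})-f(\mathbf{x}^\star)|\le\frac{1}{\sum_{i=0}^{k-1}\tau_i}\left(\frac{3+\log(k+1)}{2}D_{\star,1}+\|\mathbf{x}_0\|^2+\|\mathbf{y}_0\|^2+\sum_{i=0}^{k-1}5\tau_i^2G^2\right)=\widetilde{O}\left(\frac{1}{\sqrt{k}}\right),$$ $$\sum_{i=1}^n\mathbb{E}[\max(0,g_i(\mathbf{x}_k^{\mathsf{out}}))]\le\frac{1}{\sum_{i=0}^{k-1}\tau_i}\left(\frac{3+\log(k+1)}{2}D_{\star,2}+\|\mathbf{x}_0\|^2+\|\mathbf{y}_0\|^2+\sum_{i=0}^{k-1}5\tau_i^2G^2\right)=\widetilde{O}\left(\frac{1}{\sqrt{k}}\right),$$ where $$D_{\star,1}=\|\mathbf{x}^\star-\mathbf{x}_0\|^2+2\big(\|\mathbf{y}^\star-\mathbf{y}_0\|^2+\|\mathbf{y}^\star\|^2\big)+\|\mathbf{y}_0\|^2,\qquad D_{\star,2}=\|\mathbf{x}^\star-\mathbf{x}_0\|^2+\|\mathbf{y}^\star+\mathbf{1}-\mathbf{y}_0\|^2+\|\mathbf{y}_0\|^2,$$ and $\mathbf{1}\in\mathbb{R}^n$ is the all-ones vector.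
   Context: $\|\cdot\|$ is the Euclidean norm and $P_Z$ the Euclidean projection onto $Z$. The stochastic oracles satisfy, for all $\mathbf{x}\in\mathbb{R}^d$ and all $i$: $\mathbb{E}[\widetilde{\nabla}f(\mathbf{x})]\in\partial f(\mathbf{x})$, $\mathbb{E}[\widetilde{\nabla}g_i(\mathbf{x})]\in\partial g_i(\mathbf{x})$, $\mathbb{E}[\widetilde{g_i}(\mathbf{x})]=g_i(\mathbf{x})$. For $\mathbf{z}=(\mathbf{x},\mathbf{y})\in Z$, draw $i\sim\mathrm{Unif}\{1,\dots,n\}$ independently of the other oracle randomness and set $$\widetilde{F}(\mathbf{z})=\begin{pmatrix}\widetilde{\nabla}f(\mathbf{x})+n\,y_i\widetilde{\nabla}g_i(\mathbf{x})\\ -n\,\widetilde{g_i}(\mathbf{x})\,\mathbf{e}_i\end{pmatrix},\qquad F(\mathbf{z})=\mathbb{E}[\widetilde{F}(\mathbf{z})]=\begin{pmatrix}\mathbb{E}[\widetilde{\nabla}f(\mathbf{x})]+\sum_{i=1}^n y_i\mathbb{E}[\widetilde{\nabla}g_i(\mathbf{x})]\\ -(g_1(\mathbf{x}),\dots,g_n(\mathbf{x}))^\top\end{pmatrix},$$ where $\mathbf{e}_i$ is the $i$-th standard basis vector of $\mathbb{R}^n$. $\mathbf{z}_0$ is deterministic. At each iteration $\widetilde{F}$ is evaluated with fresh randomness independent of the past, so that, conditionally on $\mathbf{z}_1,\dots,\mathbf{z}_k$, $\widetilde{F}(\mathbf{z}_k)$ has mean $F(\mathbf{z}_k)$ and second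 moment at most $B^2\|\mathbf{z}_k-\mathbf{z}_0\|^2+G^2$. $\widetilde{O}$ hides factors polylogarithmic in $k$ and constants independent of $k$ (as $k\to\infty$). *)

theory Defs
  imports "HOL-Probability.Probability" "HOL-Library.Landau_Symbols"
begin

text \<open>The constraints are indexed by the finite type \<open>'n\<close>; the product type
  \<open>(real ^ 'd) \<times> (real ^ 'n)\<close> carries the Euclidean norm of the concatenated vector.\<close>

definition subdifferential :: "('a::real_inner \<Rightarrow> real) \<Rightarrow> 'a \<Rightarrow> 'a set" where
  "subdifferential h x = {v. \<forall>x'. h x' \<ge> h x + v \<bullet> (x' - x)}"

definition primal_dual_set :: "((real ^ 'd) \<times> (real ^ 'n)) set" where
  "primal_dual_set = UNIV \<times> {y. \<forall>i. 0 \<le> y $ i}"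

definition lagrangian ::
  "(real ^ 'd \<Rightarrow> real) \<Rightarrow> ('n::finite \<Rightarrow> real ^ 'd \<Rightarrow> real) \<Rightarrow> real ^ 'd \<Rightarrow> real ^ 'n \<Rightarrow> real" where
  "lagrangian f g x y = f x + (\<Sum>i\<in>UNIV. y $ i * g i x)"

definition saddle_point ::
  "(real ^ 'd \<Rightarrow> real) \<Rightarrow> ('n::finite \<Rightarrow> real ^ 'd \<Rightarrow> real) \<Rightarrow> real ^ 'd \<Rightarrow> real ^ 'n \<Rightarrow> bool" where
  "saddle_point f g xs ys \<longleftrightarrow> (xs, ys) \<in> primal_dual_set \<and>
     (\<forall>(x, y) \<in> primal_dual_set.
        lagrangian f g xs y \<le> lagrangian f g xs ys \<and>
        lagrangian f g xs ys \<le> lagrangian f g x ys)"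

text \<open>One draw of all the randomness used by the operator: the randomness \<open>w\<close> of the three oracles,
  with law \<open>P\<close>, together with an independent uniformly distributed constraint index \<open>i\<close>.\<close>

definition sample_measure :: "'w measure \<Rightarrow> ('w \<times> 'n::finite) measure" where
  "sample_measure P = P \<Otimes>\<^sub>M uniform_count_measure UNIV"

text \<open>\<open>nf x w\<close>, \<open>ng i x w\<close> and \<open>gt i x w\<close> are the stochastic oracles for a subgradient of the objective
  \<open>f\<close>, a subgradient of the constraint \<open>g i\<close>, and the value of \<open>g i\<close>, evaluated at \<open>x\<close>.\<close>

definition stoch_operator ::
  "(real ^ 'd \<Rightarrow> 'w \<Rightarrow> real ^ 'd) \<Rightarrow> ('n::finite \<Rightarrow> real ^ 'd \<Rightarrow> 'w \<Rightarrow> real ^ 'd) \<Rightarrow>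
   ('n \<Rightarrow> real ^ 'd \<Rightarrow> 'w \<Rightarrow> real) \<Rightarrow>
   (real ^ 'd) \<times> (real ^ 'n) \<Rightarrow> 'w \<times> 'n \<Rightarrow> (real ^ 'd) \<times> (real ^ 'n)" where
  "stoch_operator nf ng gt = (\<lambda>(x, y) (w, i).
     (nf x w + (real CARD('n) * y $ i) *\<^sub>R ng i x w,
      - ((real CARD('n) * gt i x w) *\<^sub>R axis i 1)))"

definition mean_operator ::
  "'w measure \<Rightarrow>
   (real ^ 'd \<Rightarrow> 'w \<Rightarrow> real ^ 'd) \<Rightarrow> ('n::finite \<Rightarrow> real ^ 'd \<Rightarrow> 'w \<Rightarrow> real ^ 'd) \<Rightarrow>
   ('n \<Rightarrow> real ^ 'd \<Rightarrow> 'w \<Rightarrow> real) \<Rightarrow>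
   (real ^ 'd) \<times> (real ^ 'n) \<Rightarrow> (real ^ 'd) \<times> (real ^ 'n)" where
  "mean_operator P nf ng gt z = (\<integral>s. stoch_operator nf ng gt z s \<partial>sample_measure P)"

lemma mean_operator_eq:
  fixes ng :: "'n::finite \<Rightarrow> real ^ 'd \<Rightarrow> 'w \<Rightarrow> real ^ 'd"
  assumes P: "prob_space P"
    and nf: "integrable P (nf x)"
    and ng: "\<And>i. integrable P (ng i x)"
    and gt: "\<And>i. integrable P (gt i x)"
  shows "mean_operator P nf ng gt (x, y) =
    ((\<integral>w. nf x w \<partial>P) + (\<Sum>i\<in>UNIV. y $ i *\<^sub>R (\<integral>w. ng i x w \<partial>P)),
     - (\<chi> i. \<integral>w. gt i x w \<partial>P))"
proof -
  let ?U = "uniform_count_measure (UNIV :: 'n set)"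
  let ?N = "real CARD('n)"
  define h where "h i w = stoch_operator nf ng gt (x, y) (w, i)" for i w
  interpret P: prob_space P by (rule P)
  interpret U: prob_space ?U by (rule prob_space_uniform_count_measure) auto
  interpret PU: pair_prob_space P ?U ..
  have h: "h i w = (nf x w + (?N * y $ i) *\<^sub>R ng i x w, - ((?N * gt i x w) *\<^sub>R axis i 1))" for i w
    by (simp add: h_def stoch_operator_def)
  have pair_integrable: "integrable P (\<lambda>w. (u w, v w))"
    if "integrable P u" "integrable P v" for u :: "'w \<Rightarrow> real ^ 'd" and v :: "'w \<Rightarrow> real ^ 'n"
  proof -
    have "integrable P (\<lambda>w. (u w, 0 :: real ^ 'n) + (0 :: real ^ 'd, v w))"
      using that by (intro Bochner_Integration.integrable_add
          integrable_bounded_linear[OF bounded_linear_Pair[OF bounded_linear_ident bounded_linear_zero]]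
          integrable_bounded_linear[OF bounded_linear_Pair[OF bounded_linear_zero bounded_linear_ident]])
    then show ?thesis by simp
  qed
  have pair_integral: "(\<integral>w. (u w, v w) \<partial>P) = (\<integral>w. u w \<partial>P, \<integral>w. v w \<partial>P)"
    if "integrable P u" "integrable P v" for u :: "'w \<Rightarrow> real ^ 'd" and v :: "'w \<Rightarrow> real ^ 'n"
    using integral_bounded_linear[OF bounded_linear_fst pair_integrable[OF that]]
      integral_bounded_linear[OF bounded_linear_snd pair_integrable[OF that]]
    by (simp add: prod_eq_iff)
  have int_snd: "integrable P (\<lambda>w. (?N * gt i x w) *\<^sub>R axis i (1::real))" for i
    using gt[of i] by auto
  have hi: "integrable P (h i)" for i
    unfolding h using nf ng[of i] int_snd[of i] by (intro pair_integrable) auto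
  have hint: "(\<integral>w. h i w \<partial>P) = ((\<integral>w. nf x w \<partial>P) + (?N * y $ i) *\<^sub>R (\<integral>w. ng i x w \<partial>P),
      - ((?N * (\<integral>w. gt i x w \<partial>P)) *\<^sub>R axis i 1))" for i
    unfolding h using nf ng[of i] gt[of i] int_snd[of i] by (subst pair_integral) auto
  have Uint: "integrable ?U u" for u :: "'n \<Rightarrow> 'e::{banach,second_countable_topology}"
    by (simp add: uniform_count_measure_def integrable_point_measure_finite)
  have Uint_eq: "integral\<^sup>L ?U u = (1 / ?N) *\<^sub>R (\<Sum>i\<in>UNIV. u i)"
    for u :: "'n \<Rightarrow> 'e::{banach,second_countable_topology}"
    by (simp add: uniform_count_measure_def lebesgue_integral_point_measure_finite scaleR_right.sum)
  have meas: "(\<lambda>s. h (snd s) (fst s)) \<in> borel_measurable (P \<Otimes>\<^sub>M ?U)"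
  proof (rule measurable_compose_countable[where f = "\<lambda>i s. h i (fst s)" and g = snd])
    show "(\<lambda>s. h i (fst s)) \<in> borel_measurable (P \<Otimes>\<^sub>M ?U)" for i
      using hi[of i] by measurable
    show "snd \<in> P \<Otimes>\<^sub>M ?U \<rightarrow>\<^sub>M count_space UNIV"
      by (subst measurable_cong_sets[OF refl sets_uniform_count_measure_count_space[symmetric]]) simp
  qed
  have int: "integrable (P \<Otimes>\<^sub>M ?U) (\<lambda>s. h (snd s) (fst s))"
  proof (rule PU.Fubini_integrable[OF meas])
    show "integrable P (\<lambda>w. \<integral>i. norm (h (snd (w, i)) (fst (w, i))) \<partial>?U)"
      using hi by (simp add: integral_uniform_count_measure)
    show "AE w in P. integrable ?U (\<lambda>i. h (snd (w, i)) (fst (w, i)))"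
      by (simp add: Uint)
  qed
  have "mean_operator P nf ng gt (x, y) = (\<integral>s. h (snd s) (fst s) \<partial>(P \<Otimes>\<^sub>M ?U))"
    by (simp add: mean_operator_def sample_measure_def h_def)
  also have "\<dots> = (\<integral>w. (\<integral>i. h i w \<partial>?U) \<partial>P)"
    using PU.integral_fst'[OF int] by simp
  also have "\<dots> = (\<integral>w. (1 / ?N) *\<^sub>R (\<Sum>i\<in>UNIV. h i w) \<partial>P)"
    by (simp add: Uint_eq)
  also have "\<dots> = (1 / ?N) *\<^sub>R (\<Sum>i\<in>UNIV. \<integral>w. h i w \<partial>P)"
    using hi by simp
  also have "\<dots> = ((\<integral>w. nf x w \<partial>P) + (\<Sum>i\<in>UNIV. y $ i *\<^sub>R (\<integral>w. ng i x w \<partial>P)),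
     - (\<chi> i. \<integral>w. gt i x w \<partial>P))"
  proof (rule prod_eqI)
    show "fst ((1 / ?N) *\<^sub>R (\<Sum>i\<in>UNIV. \<integral>w. h i w \<partial>P)) = fst ((\<integral>w. nf x w \<partial>P) + (\<Sum>i\<in>UNIV. y $ i *\<^sub>R (\<integral>w. ng i x w \<partial>P)),
     - (\<chi> i. \<integral>w. gt i x w \<partial>P))"
      by (simp add: hint fst_sum sum.distrib scaleR_right_distrib scaleR_right.sum sum_constant_scaleR del: sum_constant)
    show "snd ((1 / ?N) *\<^sub>R (\<Sum>i\<in>UNIV. \<integral>w. h i w \<partial>P)) = snd ((\<integral>w. nf x w \<partial>P) + (\<Sum>i\<in>UNIV. y $ i *\<^sub>R (\<integral>w. ng i x w \<partial>P)),
     - (\<chi> i. \<integral>w. gt i x w \<partial>P))"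
      by (simp add: hint snd_sum vec_eq_iff axis_def sum_negf if_distrib cong: if_cong)
  qed
  finally show ?thesis .
qed

definition anchor_weight :: "nat \<Rightarrow> real" where
  "anchor_weight k = 1 / (real k + 2)"

definition step_size :: "real \<Rightarrow> nat \<Rightarrow> real" where
  "step_size B k = 1 / (5 * B * sqrt (real k + 2))"

definition averaged_iterate :: "real \<Rightarrow> (nat \<Rightarrow> 'v::real_vector) \<Rightarrow> nat \<Rightarrow> 'v" where
  "averaged_iterate B x k =
     (1 / (\<Sum>i<k. step_size B i)) *\<^sub>R (\<Sum>i<k. step_size B i *\<^sub>R x i)"

definition rate_bound ::
  "real \<Rightarrow> real \<Rightarrow> 'v::real_normed_vector \<Rightarrow> 'u::real_normed_vector \<Rightarrow> real \<Rightarrow> nat \<Rightarrow> real" where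
  "rate_bound B G x0 y0 D k =
     1 / (\<Sum>i<k. step_size B i) *
       ((3 + ln (real k + 1)) / 2 * D + (norm x0)\<^sup>2 + (norm y0)\<^sup>2
         + (\<Sum>i<k. 5 * (step_size B i)\<^sup>2 * G\<^sup>2))"

text \<open>\<open>O\<close> with hidden polylogarithmic factors, as the argument tends to infinity.\<close>

definition soft_bigo :: "(nat \<Rightarrow> real) \<Rightarrow> (nat \<Rightarrow> real) set" where
  "soft_bigo u = {h. \<exists>p::nat. h \<in> O(\<lambda>k. ln (real k) ^ p * u k)}"

end

theory Submission
  imports Defs
begin

text \<open>
  Write \<open>F\<close> for the mean operator. Subgradient inequalities and unbiasedness give, for every
  \<open>(x', y')\<close> in \<open>Z\<close>, that \<open>F (x, y) \<bullet> ((x, y) - (x', y'))\<close> dominates the Lagrangian gap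
  \<open>L (x, y') - L (x', y)\<close> (\<open>mean_operator_gap\<close>). With \<open>x' = x*\<close> the saddle point inequalities give
  \<open>L (x*, y) \<le> f x*\<close>, and the average inherits the bound by convexity, so a bound on the weighted sum of
  \<open>F z\<^sub>i \<bullet> (z\<^sub>i - u)\<close> with \<open>u = (x*, y')\<close> bounds \<open>L (x_out, y') - f x*\<close>. Both error measures are such
  gaps for suitable \<open>y'\<close>: \<open>y' = 0\<close> and \<open>y' = 2 y*\<close> together bound the objective error, and \<open>y*\<close> plus the
  indicator of the violated constraints bounds the total violation.

  These choices of \<open>y'\<close> are decided by the random output, so expectations may only be taken after the bound
  has been made uniform in the comparison point \<open>u\<close>. The projection inequality telescopes along each
  trajectory. The noise enters against \<open>u\<close> only through the inner product of \<open>u - z\<^sub>0\<close> with the sum of all noise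
  terms; Young's inequality replaces it by \<open>D\<close> plus a quarter of the squared norm of this sum, where \<open>D\<close> bounds
  \<open>(norm (u - z\<^sub>0))\<^sup>2\<close>. Then a single random variable majorises the gap for all admissible \<open>u\<close> at once
  (\<open>anchored_projection_uniform_bound\<close>).

  In expectation, the noise is orthogonal to the past: the linear noise term vanishes and the squared norm of
  the noise sum is at most the sum of the second moments. These grow with the distance from the anchor like
  \<open>B\<^sup>2 (norm (z\<^sub>i - z\<^sub>0))\<^sup>2\<close>, but the anchoring leaves negative terms \<open>- \<beta>\<^sub>i (norm (z\<^sub>i\<^sub>+\<^sub>1 - z\<^sub>0))\<^sup>2 / 2\<close>, and since
  \<open>\<tau>\<^sub>i\<^sup>2 B\<^sup>2 = \<beta>\<^sub>i / 25\<close> they absorb the growth (\<open>gap_majorant\<close>). This is why neither the domain nor the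
  noise has to be bounded. The logarithm is the sum of the anchor weights.
\<close>

section \<open>One anchored projection step and its telescoped form\<close>

text \<open>Expanding the variational inequality of the projection at \<open>z\<close> by polarization keeps the two squares
  \<open>b * (norm (w - z0))\<^sup>2\<close> and \<open>(1 - b) * (norm (v - w))\<^sup>2\<close>. The second pays
  for the displacement \<open>T \<bullet> (v - w)\<close>; the first is kept to absorb the growth of the second moments of
  the oracle.\<close>

lemma anchored_projection_step:
  fixes v z z0 T :: "'e::euclidean_space"
  assumes Z: "convex Z" "closed Z" "z \<in> Z" and b: "0 \<le> b" "b \<le> 1/2"
    and w: "w = closest_point Z (b *\<^sub>R z0 + (1 - b) *\<^sub>R v - t *\<^sub>R T)"
  shows "2 * t * (T \<bullet> (v - z)) + b * (norm (w - z0))\<^sup>2 + (norm (w - z))\<^sup>2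
    \<le> b * (norm (z0 - z))\<^sup>2 + (1 - b) * (norm (v - z))\<^sup>2 + 2 * t\<^sup>2 * (norm T)\<^sup>2"
proof -
  define u d e where "u = z0 - w" and "d = v - w" and "e = z - w"
  have proj: "(b *\<^sub>R z0 + (1 - b) *\<^sub>R v - t *\<^sub>R T - w) \<bullet> e \<le> 0"
    unfolding e_def w by (rule closest_point_dot) (use Z in auto)
  have "b *\<^sub>R z0 + (1 - b) *\<^sub>R v - t *\<^sub>R T - w = b *\<^sub>R u + (1 - b) *\<^sub>R d - t *\<^sub>R T"
    by (simp add: u_def d_def algebra_simps)
  with proj have "(b *\<^sub>R u + (1 - b) *\<^sub>R d - t *\<^sub>R T) \<bullet> e \<le> 0" by simp
  then have 1: "b * (2 * (u \<bullet> e)) + (1 - b) * (2 * (d \<bullet> e)) - 2 * t * (T \<bullet> e) \<le> 0"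
    unfolding inner_diff_left inner_add_left inner_scaleR_left by linarith
  have 2: "2 * (u \<bullet> e) = (norm (w - z0))\<^sup>2 + (norm (w - z))\<^sup>2 - (norm (z0 - z))\<^sup>2"
    by (simp add: u_def e_def power2_norm_eq_inner algebra_simps inner_commute)
  have 3: "2 * (d \<bullet> e) = (norm d)\<^sup>2 + (norm (w - z))\<^sup>2 - (norm (v - z))\<^sup>2"
    by (simp add: d_def e_def power2_norm_eq_inner algebra_simps inner_commute)
  have 4: "T \<bullet> (v - z) = T \<bullet> d - T \<bullet> e"
    by (simp add: d_def e_def algebra_simps)
  have "0 \<le> (norm (d - (2 * t) *\<^sub>R T))\<^sup>2" by simp
  also have "\<dots> = (norm d)\<^sup>2 - 4 * t * (T \<bullet> d) + 4 * t\<^sup>2 * (norm T)\<^sup>2"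
    unfolding power2_norm_eq_inner by (simp add: algebra_simps inner_commute power2_eq_square)
  finally have 5: "2 * t * (T \<bullet> d) \<le> (norm d)\<^sup>2 / 2 + 2 * t\<^sup>2 * (norm T)\<^sup>2" by simp
  have 6: "(norm d)\<^sup>2 / 2 \<le> (1 - b) * (norm d)\<^sup>2"
    using mult_right_mono[of "1/2" "1 - b" "(norm d)\<^sup>2"] b by simp
  show ?thesis using 1 5 6 unfolding 2 3 4 by (simp add: algebra_simps)
qed

lemma anchored_projection_telescope:
  fixes v T :: "nat \<Rightarrow> 'e::euclidean_space"
  assumes Z: "convex Z" "closed Z" "z \<in> Z" and b: "\<And>i. 0 \<le> b i" "\<And>i. b i \<le> 1/2"
    and v: "v 0 = z0"
      "\<And>i. v (Suc i) = closest_point Z (b i *\<^sub>R z0 + (1 - b i) *\<^sub>R v i - t i *\<^sub>R T i)"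
  shows "2 * (\<Sum>i<k. t i * (T i \<bullet> (v i - z))) + (\<Sum>i<k. b i * (norm (v (Suc i) - z0))\<^sup>2) + (norm (v k - z))\<^sup>2
    \<le> (1 + (\<Sum>i<k. b i)) * (norm (z0 - z))\<^sup>2 + 2 * (\<Sum>i<k. (t i)\<^sup>2 * (norm (T i))\<^sup>2)"
proof (induction k)
  case 0
  then show ?case by (simp add: v)
next
  case (Suc k)
  have "(1 - b k) * (norm (v k - z))\<^sup>2 \<le> (norm (v k - z))\<^sup>2"
    using b[of k] by (simp add: mult_left_le_one_le)
  with Suc anchored_projection_step[OF Z b v(2), of k] show ?case
    by (simp add: algebra_simps)
qed

text \<open>The right-hand side is free of \<open>z\<close>, so the bound holds for comparison points that depend on the whole
  trajectory. Here \<open>T i\<close> is the operator value used by the recursion and \<open>F i\<close> the value of interest; the anchor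
  \<open>z0\<close> splits \<open>v i - z\<close> into \<open>v i - z0\<close>, which depends on the steps before \<open>i\<close> only, and \<open>z0 - z\<close>, which does
  not depend on \<open>i\<close> and is moved out of the sum.\<close>

lemma anchored_projection_uniform_bound:
  fixes v T F :: "nat \<Rightarrow> 'e::euclidean_space"
  assumes Z: "convex Z" "closed Z" "z \<in> Z" and b: "\<And>i. 0 \<le> b i" "\<And>i. b i \<le> 1/2"
    and v: "v 0 = z0"
      "\<And>i. v (Suc i) = closest_point Z (b i *\<^sub>R z0 + (1 - b i) *\<^sub>R v i - t i *\<^sub>R T i)"
    and D: "(norm (z - z0))\<^sup>2 \<le> D"
  shows "(\<Sum>i<k. t i * (F i \<bullet> (v i - z)))
    \<le> (3 + (\<Sum>i<k. b i)) / 2 * D - (\<Sum>i<k. b i * (norm (v (Suc i) - z0))\<^sup>2) / 2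
      + (\<Sum>i<k. (t i)\<^sup>2 * (norm (T i))\<^sup>2)
      + (\<Sum>i<k. t i * ((v i - z0) \<bullet> (F i - T i)))
      + (norm (\<Sum>i<k. t i *\<^sub>R (F i - T i)))\<^sup>2 / 4"
proof -
  define N where "N = (\<Sum>i<k. t i *\<^sub>R (F i - T i))"
  have split: "(\<Sum>i<k. t i * (F i \<bullet> (v i - z))) = (\<Sum>i<k. t i * (T i \<bullet> (v i - z)))
     + (\<Sum>i<k. t i * ((v i - z0) \<bullet> (F i - T i))) - N \<bullet> (z - z0)"
    unfolding N_def inner_sum_left sum.distrib[symmetric] sum_subtractf[symmetric]
    by (intro sum.cong refl) (simp add: algebra_simps inner_commute)
  \<comment> \<open>The weights of Young's inequality are chosen to cost exactly \<open>D\<close>, which is what raises the constant \<open>1\<close> of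
    the telescoped bound to \<open>3\<close>.\<close>
  have "0 \<le> (norm ((1/2) *\<^sub>R N + (z - z0)))\<^sup>2" by simp
  also have "\<dots> = (norm N)\<^sup>2 / 4 + N \<bullet> (z - z0) + (norm (z - z0))\<^sup>2"
    by (simp only: power2_norm_eq_inner inner_add_left inner_add_right inner_scaleR_left
        inner_scaleR_right inner_commute[of "z - z0" N]) (simp add: field_simps)
  finally have young: "- (N \<bullet> (z - z0)) \<le> (norm N)\<^sup>2 / 4 + D" using D by simp
  have "(1 + (\<Sum>i<k. b i)) * (norm (z0 - z))\<^sup>2 \<le> (1 + (\<Sum>i<k. b i)) * D"
    using D by (intro mult_left_mono) (auto simp: norm_minus_commute b(1) intro!: add_nonneg_nonneg sum_nonneg)
  moreover note anchored_projection_telescope[OF Z b v, of k]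
  moreover have "0 \<le> (norm (v k - z))\<^sup>2" by simp
  ultimately have tele: "2 * (\<Sum>i<k. t i * (T i \<bullet> (v i - z))) + (\<Sum>i<k. b i * (norm (v (Suc i) - z0))\<^sup>2)
    \<le> (1 + (\<Sum>i<k. b i)) * D + 2 * (\<Sum>i<k. (t i)\<^sup>2 * (norm (T i))\<^sup>2)"
    by linarith
  have "(3 + (\<Sum>i<k. b i)) / 2 * D = (1 + (\<Sum>i<k. b i)) * D / 2 + D" by (simp add: field_simps)
  with tele young split show ?thesis unfolding N_def[symmetric] by linarith
qed

section \<open>Integrating out fresh randomness\<close>

text \<open>The state at time \<open>k\<close> is a measurable function of \<open>\<xi> 0, \<dots>, \<xi> (k - 1)\<close>, hence independent of \<open>\<xi> k\<close>.
  Independence is expressed by the product form of the joint law because \<open>indep_var\<close> compares variables of a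
  common type, which states and samples do not have.\<close>

lemma (in prob_space) recursion_fresh_joint_law:
  assumes ind: "indep_vars (\<lambda>_. S) \<xi> UNIV"
    and init: "init \<in> space N" and V_0: "\<And>\<omega>. V 0 \<omega> = init"
    and VSuc: "\<And>k \<omega>. V (Suc k) \<omega> = step k (V k \<omega>) (\<xi> k \<omega>)"
    and step: "\<And>k. case_prod (step k) \<in> N \<Otimes>\<^sub>M S \<rightarrow>\<^sub>M N"
  shows "V k \<in> M \<rightarrow>\<^sub>M N" "\<xi> k \<in> M \<rightarrow>\<^sub>M S"
    "distr M (N \<Otimes>\<^sub>M S) (\<lambda>\<omega>. (V k \<omega>, \<xi> k \<omega>)) = distr M N (V k) \<Otimes>\<^sub>M distr M S (\<xi> k)"
proof -
  have "\<exists>\<phi> \<in> PiM {..<k} (\<lambda>_. S) \<rightarrow>\<^sub>M N. \<forall>\<omega>. V k \<omega> = \<phi> (restrict (\<lambda>i. \<xi> i \<omega>) {..<k})"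
  proof (induction k)
    case 0
    show ?case by (intro bexI[of _ "\<lambda>_. init"]) (auto simp: V_0 init)
  next
    case (Suc k)
    then obtain \<phi> where \<phi>[measurable]: "\<phi> \<in> PiM {..<k} (\<lambda>_. S) \<rightarrow>\<^sub>M N"
      and eq: "\<And>\<omega>. V k \<omega> = \<phi> (restrict (\<lambda>i. \<xi> i \<omega>) {..<k})" by blast
    have [measurable]: "(\<lambda>u. restrict u {..<k}) \<in> PiM {..<Suc k} (\<lambda>_. S) \<rightarrow>\<^sub>M PiM {..<k} (\<lambda>_. S)"
      by (rule measurable_restrict_subset) auto
    have [measurable]: "(\<lambda>u. u k) \<in> PiM {..<Suc k} (\<lambda>_. S) \<rightarrow>\<^sub>M S"
      by (rule measurable_component_singleton) auto
    show ?case
    proof (intro bexI[of _ "\<lambda>u. case_prod (step k) (\<phi> (restrict u {..<k}), u k)"] allI)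
      show "V (Suc k) \<omega> = case_prod (step k) (\<phi> (restrict (restrict (\<lambda>i. \<xi> i \<omega>) {..<Suc k}) {..<k}),
          restrict (\<lambda>i. \<xi> i \<omega>) {..<Suc k} k)" for \<omega>
        by (simp add: VSuc eq restrict_restrict Int_absorb1 lessThan_Suc Int_commute)
      show "(\<lambda>u. case_prod (step k) (\<phi> (restrict u {..<k}), u k)) \<in> PiM {..<Suc k} (\<lambda>_. S) \<rightarrow>\<^sub>M N"
        by (rule measurable_compose[OF _ step]) measurable
    qed
  qed
  then obtain \<phi> where \<phi>[measurable]: "\<phi> \<in> PiM {..<k} (\<lambda>_. S) \<rightarrow>\<^sub>M N"
    and eq: "\<And>\<omega>. V k \<omega> = \<phi> (restrict (\<lambda>i. \<xi> i \<omega>) {..<k})" by blast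
  then have eqf: "V k = (\<lambda>\<omega>. \<phi> (restrict (\<lambda>i. \<xi> i \<omega>) {..<k}))" by auto
  let ?past = "\<lambda>\<omega>. restrict (\<lambda>i. \<xi> i \<omega>) {..<k}" and ?fresh = "\<lambda>\<omega>. restrict (\<lambda>i. \<xi> i \<omega>) {k}"
  let ?A = "PiM {..<k} (\<lambda>_. S)" and ?B = "PiM {k} (\<lambda>_. S)"
  have "indep_var ?A ?past ?B ?fresh"
    by (rule indep_var_restrict[OF ind]) auto
  then have past: "?past \<in> M \<rightarrow>\<^sub>M ?A" and fresh: "?fresh \<in> M \<rightarrow>\<^sub>M ?B"
    and joint: "distr M ?A ?past \<Otimes>\<^sub>M distr M ?B ?fresh = distr M (?A \<Otimes>\<^sub>M ?B) (\<lambda>\<omega>. (?past \<omega>, ?fresh \<omega>))"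
    unfolding indep_var_distribution_eq by auto
  have pr[measurable]: "(\<lambda>u. u k) \<in> ?B \<rightarrow>\<^sub>M S"
    by (rule measurable_component_singleton) simp
  have V: "distr M N (V k) = distr (distr M ?A ?past) N \<phi>"
    by (subst distr_distr) (use past \<phi> in \<open>auto simp: comp_def eqf\<close>)
  have X: "distr M S (\<xi> k) = distr (distr M ?B ?fresh) S (\<lambda>u. u k)"
    by (subst distr_distr) (use fresh in \<open>auto simp: comp_def\<close>)
  have "V k = \<phi> \<circ> ?past" "\<xi> k = (\<lambda>u. u k) \<circ> ?fresh"
    by (auto simp: eq)
  then show meas: "V k \<in> M \<rightarrow>\<^sub>M N" "\<xi> k \<in> M \<rightarrow>\<^sub>M S"
    using measurable_comp[OF past \<phi>] measurable_comp[OF fresh pr] by metis+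
  interpret D: prob_space "distr (distr M ?B ?fresh) S (\<lambda>u. u k)"
    unfolding X[symmetric] by (rule prob_space_distr) (rule meas)
  have "distr M N (V k) \<Otimes>\<^sub>M distr M S (\<xi> k)
      = distr (distr M ?A ?past \<Otimes>\<^sub>M distr M ?B ?fresh) (N \<Otimes>\<^sub>M S) (\<lambda>(u, w). (\<phi> u, w k))"
    unfolding V X by (rule pair_measure_distr) (auto intro: D.sigma_finite_measure_axioms)
  also have "\<dots> = distr M (N \<Otimes>\<^sub>M S) (\<lambda>\<omega>. (V k \<omega>, \<xi> k \<omega>))"
    unfolding joint
    by (subst distr_distr) (use past fresh in \<open>auto simp: comp_def eq\<close>)
  finally show "distr M (N \<Otimes>\<^sub>M S) (\<lambda>\<omega>. (V k \<omega>, \<xi> k \<omega>)) = distr M N (V k) \<Otimes>\<^sub>M distr M S (\<xi> k)" ..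
qed

locale fresh_randomness = prob_space M for M :: "'a measure" +
  fixes N :: "'v measure" and V :: "'a \<Rightarrow> 'v" and S :: "'s measure" and Y :: "'a \<Rightarrow> 's"
  assumes V_measurable[measurable]: "V \<in> M \<rightarrow>\<^sub>M N" and Y_measurable[measurable]: "Y \<in> M \<rightarrow>\<^sub>M S"
    and joint_law: "distr M (N \<Otimes>\<^sub>M S) (\<lambda>\<omega>. (V \<omega>, Y \<omega>)) = distr M N V \<Otimes>\<^sub>M S"
    and prob_space_S: "prob_space S"
begin

sublocale S: prob_space S by (rule prob_space_S)

sublocale VS: pair_sigma_finite "distr M N V" S
proof -
  interpret V: prob_space "distr M N V" by (rule prob_space_distr) simp
  show "pair_sigma_finite (distr M N V) S" ..
qed

text \<open>The two transfer lemmas below are the conditional expectation given \<open>V\<close>, computed by integrating over \<open>Y\<close>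
  with \<open>V\<close> frozen.\<close>

lemma nn_integral_fresh:
  assumes h[measurable]: "h \<in> borel_measurable (N \<Otimes>\<^sub>M S)"
  shows "(\<integral>\<^sup>+\<omega>. h (V \<omega>, Y \<omega>) \<partial>M) = (\<integral>\<^sup>+\<omega>. (\<integral>\<^sup>+s. h (V \<omega>, s) \<partial>S) \<partial>M)"
proof -
  have "(\<integral>\<^sup>+\<omega>. h (V \<omega>, Y \<omega>) \<partial>M) = (\<integral>\<^sup>+p. h p \<partial>(distr M N V \<Otimes>\<^sub>M S))"
    unfolding joint_law[symmetric] by (subst nn_integral_distr) simp_all
  also have "\<dots> = (\<integral>\<^sup>+v. (\<integral>\<^sup>+s. h (v, s) \<partial>S) \<partial>distr M N V)"
    by (subst S.nn_integral_fst) (simp_all)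
  also have "\<dots> = (\<integral>\<^sup>+\<omega>. (\<integral>\<^sup>+s. h (V \<omega>, s) \<partial>S) \<partial>M)"
    by (subst nn_integral_distr) simp_all
  finally show ?thesis .
qed

lemma integral_fresh:
  fixes h :: "_ \<Rightarrow> real"
  assumes h[measurable]: "h \<in> borel_measurable (N \<Otimes>\<^sub>M S)"
    and int: "integrable M (\<lambda>\<omega>. h (V \<omega>, Y \<omega>))"
  shows "(\<integral>\<omega>. h (V \<omega>, Y \<omega>) \<partial>M) = (\<integral>\<omega>. (\<integral>s. h (V \<omega>, s) \<partial>S) \<partial>M)"
proof -
  have "integrable (distr M (N \<Otimes>\<^sub>M S) (\<lambda>\<omega>. (V \<omega>, Y \<omega>))) h"
    using int by (subst integrable_distr_eq) simp_all
  then have int': "integrable (distr M N V \<Otimes>\<^sub>M S) h"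
    unfolding joint_law .
  have "(\<integral>\<omega>. h (V \<omega>, Y \<omega>) \<partial>M) = (\<integral>p. h p \<partial>(distr M N V \<Otimes>\<^sub>M S))"
    unfolding joint_law[symmetric] by (subst integral_distr) simp_all
  also have "\<dots> = (\<integral>v. (\<integral>s. h (v, s) \<partial>S) \<partial>distr M N V)"
    using VS.integral_fst'[OF int'] by simp
  also have "\<dots> = (\<integral>\<omega>. (\<integral>s. h (V \<omega>, s) \<partial>S) \<partial>M)"
    by (subst integral_distr) simp_all
  finally show ?thesis .
qed

lemma fresh_nonneg_bound:
  fixes h :: "_ \<Rightarrow> real"
  assumes h[measurable]: "h \<in> borel_measurable (N \<Otimes>\<^sub>M S)" and nonneg: "\<And>p. 0 \<le> h p"
    and cond: "\<And>\<omega>. integrable S (\<lambda>s. h (V \<omega>, s))" "\<And>\<omega>. (\<integral>s. h (V \<omega>, s) \<partial>S) \<le> c \<omega>"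
    and c: "integrable M c"
  shows "integrable M (\<lambda>\<omega>. h (V \<omega>, Y \<omega>))" "(\<integral>\<omega>. h (V \<omega>, Y \<omega>) \<partial>M) \<le> (\<integral>\<omega>. c \<omega> \<partial>M)"
proof -
  have c_nonneg: "0 \<le> c \<omega>" for \<omega>
    by (rule order_trans[OF _ cond(2)]) (simp add: nonneg)
  have "(\<integral>\<^sup>+\<omega>. ennreal (h (V \<omega>, Y \<omega>)) \<partial>M) = (\<integral>\<^sup>+\<omega>. (\<integral>\<^sup>+s. ennreal (h (V \<omega>, s)) \<partial>S) \<partial>M)"
    using nn_integral_fresh[of "\<lambda>p. ennreal (h p)"] by simp
  also have "\<dots> \<le> (\<integral>\<^sup>+\<omega>. ennreal (c \<omega>) \<partial>M)"
    by (intro nn_integral_mono) (simp add: nn_integral_eq_integral cond nonneg ennreal_leI)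
  also have "\<dots> = ennreal (\<integral>\<omega>. c \<omega> \<partial>M)"
    by (rule nn_integral_eq_integral) (use c c_nonneg in auto)
  finally have le: "(\<integral>\<^sup>+\<omega>. ennreal (h (V \<omega>, Y \<omega>)) \<partial>M) \<le> ennreal (\<integral>\<omega>. c \<omega> \<partial>M)" .
  show int: "integrable M (\<lambda>\<omega>. h (V \<omega>, Y \<omega>))"
    by (rule integrableI_bounded)
      (use le nonneg in \<open>auto simp: less_top[symmetric] top_unique\<close>)
  have "ennreal (\<integral>\<omega>. h (V \<omega>, Y \<omega>) \<partial>M) \<le> ennreal (\<integral>\<omega>. c \<omega> \<partial>M)"
    using le by (subst nn_integral_eq_integral[symmetric]) (use int nonneg in auto)
  then show "(\<integral>\<omega>. h (V \<omega>, Y \<omega>) \<partial>M) \<le> (\<integral>\<omega>. c \<omega> \<partial>M)"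
    using c_nonneg by (simp add: integral_nonneg_AE)
qed

end

section \<open>Second moments along the anchored stochastic recursion\<close>

lemma (in prob_space) square_integrable_imp_integrable_euclidean:
  fixes X :: "'a \<Rightarrow> 'e::euclidean_space"
  assumes [measurable]: "X \<in> borel_measurable M" and "integrable M (\<lambda>\<omega>. (norm (X \<omega>))\<^sup>2)"
  shows "integrable M X"
proof (rule Bochner_Integration.integrable_bound)
  show "integrable M (\<lambda>\<omega>. 1 + (norm (X \<omega>))\<^sup>2)" using assms by simp
  have "norm x \<le> 1 + (norm x)\<^sup>2" for x :: 'e
    using zero_le_power2[of "norm x - 1/2"] by (simp add: power2_eq_square algebra_simps)
  then show "AE \<omega> in M. norm (X \<omega>) \<le> norm (1 + (norm (X \<omega>))\<^sup>2)" by simp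
qed simp

lemma integrable_inner_square:
  fixes X Y :: "'a \<Rightarrow> 'e::euclidean_space"
  assumes [measurable]: "X \<in> borel_measurable M" "Y \<in> borel_measurable M"
    and "integrable M (\<lambda>\<omega>. (norm (X \<omega>))\<^sup>2)" "integrable M (\<lambda>\<omega>. (norm (Y \<omega>))\<^sup>2)"
  shows "integrable M (\<lambda>\<omega>. X \<omega> \<bullet> Y \<omega>)"
proof (rule Bochner_Integration.integrable_bound)
  show "integrable M (\<lambda>\<omega>. (norm (X \<omega>))\<^sup>2 + (norm (Y \<omega>))\<^sup>2)" using assms by simp
  have "\<bar>x \<bullet> y\<bar> \<le> (norm x)\<^sup>2 + (norm y)\<^sup>2" for x y :: 'e
  proof -
    have "\<bar>x \<bullet> y\<bar> \<le> norm x * norm y" by (rule Cauchy_Schwarz_ineq2)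
    also have "\<dots> \<le> (norm x)\<^sup>2 + (norm y)\<^sup>2"
      using sum_squares_bound[of "norm x" "norm y"] mult_nonneg_nonneg[OF norm_ge_zero[of x] norm_ge_zero[of y]] by linarith
    finally show ?thesis .
  qed
  then show "AE \<omega> in M. norm (X \<omega> \<bullet> Y \<omega>) \<le> norm ((norm (X \<omega>))\<^sup>2 + (norm (Y \<omega>))\<^sup>2)" by simp
qed simp

text \<open>The difference of the two second moments is the square of the mean.\<close>

lemma (in prob_space) second_moment_centered:
  fixes X :: "'a \<Rightarrow> 'e::euclidean_space"
  assumes X[measurable]: "X \<in> borel_measurable M" and sq: "integrable M (\<lambda>\<omega>. (norm (X \<omega>))\<^sup>2)"
  shows "integrable M (\<lambda>\<omega>. (norm (expectation X - X \<omega>))\<^sup>2)"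
    and "(\<integral>\<omega>. (norm (expectation X - X \<omega>))\<^sup>2 \<partial>M) \<le> (\<integral>\<omega>. (norm (X \<omega>))\<^sup>2 \<partial>M)"
proof -
  note int = square_integrable_imp_integrable_euclidean[OF X sq]
  have eq: "(norm (expectation X - X \<omega>))\<^sup>2 = (norm (expectation X))\<^sup>2 - 2 * (expectation X \<bullet> X \<omega>) + (norm (X \<omega>))\<^sup>2" for \<omega>
    unfolding power2_norm_eq_inner by (simp add: algebra_simps inner_commute)
  show "integrable M (\<lambda>\<omega>. (norm (expectation X - X \<omega>))\<^sup>2)"
    unfolding eq using int sq by simp
  show "(\<integral>\<omega>. (norm (expectation X - X \<omega>))\<^sup>2 \<partial>M) \<le> (\<integral>\<omega>. (norm (X \<omega>))\<^sup>2 \<partial>M)"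
    unfolding eq using int sq by (simp add: prob_space power2_norm_eq_inner)
qed

lemma anchor_weight_bounds: "0 \<le> anchor_weight k" "anchor_weight k \<le> 1 / 2"
  by (auto simp: anchor_weight_def field_simps)

lemma anchor_weight_decreasing: "anchor_weight (Suc k) \<le> anchor_weight k"
  by (simp add: anchor_weight_def field_simps)

lemma step_size_square:
  assumes "0 < B"
  shows "(step_size B k)\<^sup>2 * B\<^sup>2 = anchor_weight k / 25"
  using assms by (simp add: step_size_def anchor_weight_def power_divide power_mult_distrib)

text \<open>Each weight \<open>1 / (k + 2)\<close> is at most the increment \<open>ln (k + 2) - ln (k + 1)\<close>.\<close>

lemma sum_anchor_weight_le_ln: "(\<Sum>i<k. anchor_weight i) \<le> ln (real k + 1)"
proof (induction k)
  case (Suc k)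
  have "ln ((real k + 1) / (real k + 2)) \<le> (real k + 1) / (real k + 2) - 1"
    by (rule ln_le_minus_one) simp
  also have "\<dots> = - anchor_weight k" by (simp add: anchor_weight_def field_simps)
  finally have "anchor_weight k \<le> ln (real k + 2) - ln (real k + 1)" by (simp add: ln_div)
  with Suc show ?case by (simp add: add.commute)
qed simp

text \<open>The recursion for a general random operator \<open>T\<close> and a closed convex set \<open>Z\<close>: the probabilistic part of the
  argument sees neither the Lagrangian nor the product structure.\<close>

locale anchored_stochastic_recursion = prob_space M for M :: "'a measure" +
  fixes Z :: "'e::euclidean_space set" and S :: "'s measure" and T :: "'e \<Rightarrow> 's \<Rightarrow> 'e"
    and \<xi> :: "nat \<Rightarrow> 'a \<Rightarrow> 's" and z :: "nat \<Rightarrow> 'a \<Rightarrow> 'e" and z0 :: 'e and B G :: real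
  assumes Z: "convex Z" "closed Z" "z0 \<in> Z" and B: "0 < B"
    and S: "prob_space S" and T_measurable[measurable]: "case_prod T \<in> borel_measurable (borel \<Otimes>\<^sub>M S)"
    and T_square: "\<And>v. v \<in> Z \<Longrightarrow> integrable S (\<lambda>s. (norm (T v s))\<^sup>2)"
      "\<And>v. v \<in> Z \<Longrightarrow> (\<integral>s. (norm (T v s))\<^sup>2 \<partial>S) \<le> B\<^sup>2 * (norm (v - z0))\<^sup>2 + G\<^sup>2"
    and \<xi>: "indep_vars (\<lambda>_. S) \<xi> UNIV" "\<And>k. distr M S (\<xi> k) = S"
    and z: "\<And>\<omega>. z 0 \<omega> = z0"
      "\<And>k \<omega>. z (Suc k) \<omega> = closest_point Z
        (anchor_weight k *\<^sub>R z0 + (1 - anchor_weight k) *\<^sub>R z k \<omega> - step_size B k *\<^sub>R T (z k \<omega>) (\<xi> k \<omega>))"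
begin

sublocale S: prob_space S by (rule S)

definition F :: "'e \<Rightarrow> 'e" where
  "F v = (\<integral>s. T v s \<partial>S)"

definition noise :: "nat \<Rightarrow> 'a \<Rightarrow> 'e" where
  "noise k \<omega> = F (z k \<omega>) - T (z k \<omega>) (\<xi> k \<omega>)"

definition noise_sum :: "nat \<Rightarrow> 'a \<Rightarrow> 'e" where
  "noise_sum k \<omega> = (\<Sum>i<k. step_size B i *\<^sub>R noise i \<omega>)"

lemma F_measurable[measurable]: "F \<in> borel_measurable borel"
  unfolding F_def by measurable

lemma closest_point_measurable[measurable]: "closest_point Z \<in> borel_measurable borel"
  using Z by (intro borel_measurable_continuous_onI continuous_on_closest_point) auto

lemma z_in_Z: "z k \<omega> \<in> Z"
  using Z by (cases k) (auto simp: z intro!: closest_point_in_set)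

lemma T_measurable_snd: "T v \<in> borel_measurable S"
  using measurable_Pair2[OF T_measurable, of v] by simp

lemma T_fst_measurable[measurable]:
  "(\<lambda>p. T (fst (fst p)) (snd p)) \<in> borel_measurable ((borel \<Otimes>\<^sub>M borel) \<Otimes>\<^sub>M S)"
  using measurable_compose[OF _ T_measurable, of "\<lambda>p. (fst (fst p), snd p)" "(borel \<Otimes>\<^sub>M borel) \<Otimes>\<^sub>M S"]
  by simp

text \<open>The accumulated noise is made part of the state, since the orthogonality of the increments needs the current
  sample to be independent of the iterate and of the noise so far jointly.\<close>

sublocale fresh: fresh_randomness M "borel \<Otimes>\<^sub>M borel" "\<lambda>\<omega>. (z k \<omega>, noise_sum k \<omega>)" S "\<xi> k" for k
proof -
  let ?step = "\<lambda>k (v, a) s. (closest_point Z (anchor_weight k *\<^sub>R z0 + (1 - anchor_weight k) *\<^sub>R v - step_size B k *\<^sub>R T v s),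
      a + step_size B k *\<^sub>R (F v - T v s))"
  have step: "case_prod (?step k) \<in> (borel \<Otimes>\<^sub>M borel) \<Otimes>\<^sub>M S \<rightarrow>\<^sub>M borel \<Otimes>\<^sub>M borel" for k
    unfolding case_prod_beta by measurable
  have rec: "(z (Suc k) \<omega>, noise_sum (Suc k) \<omega>) = ?step k (z k \<omega>, noise_sum k \<omega>) (\<xi> k \<omega>)" for k \<omega>
    by (simp add: z noise_sum_def noise_def)
  note law = recursion_fresh_joint_law[where V = "\<lambda>k \<omega>. (z k \<omega>, noise_sum k \<omega>)" and step = ?step
      and init = "(z0, 0)", OF \<xi>(1) _ _ rec step, of k]
  show "fresh_randomness M (borel \<Otimes>\<^sub>M borel) (\<lambda>\<omega>. (z k \<omega>, noise_sum k \<omega>)) S (\<xi> k)"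
    by unfold_locales (use law in \<open>auto simp: z noise_sum_def \<xi>(2) space_pair_measure\<close>)
qed

lemma z_measurable[measurable]: "z k \<in> borel_measurable M"
  using measurable_compose[OF fresh.V_measurable measurable_fst] by simp

lemma noise_sum_measurable[measurable]: "noise_sum k \<in> borel_measurable M"
  using measurable_compose[OF fresh.V_measurable measurable_snd] by simp

lemma \<xi>_measurable[measurable]: "\<xi> k \<in> M \<rightarrow>\<^sub>M S"
  by (rule fresh.Y_measurable)

lemma T_z_measurable[measurable]: "(\<lambda>\<omega>. T (z k \<omega>) (\<xi> k \<omega>)) \<in> borel_measurable M"
  by measurable

lemma noise_measurable[measurable]: "noise k \<in> borel_measurable M"
  unfolding noise_def by measurable

lemma oracle_second_moment:
  assumes "integrable M (\<lambda>\<omega>. (norm (z k \<omega> - z0))\<^sup>2)"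
  shows "integrable M (\<lambda>\<omega>. (norm (T (z k \<omega>) (\<xi> k \<omega>)))\<^sup>2)"
    and "(\<integral>\<omega>. (norm (T (z k \<omega>) (\<xi> k \<omega>)))\<^sup>2 \<partial>M) \<le> B\<^sup>2 * (\<integral>\<omega>. (norm (z k \<omega> - z0))\<^sup>2 \<partial>M) + G\<^sup>2"
  using fresh.fresh_nonneg_bound[where k = k and h = "\<lambda>p. (norm (T (fst (fst p)) (snd p)))\<^sup>2"
      and c = "\<lambda>\<omega>. B\<^sup>2 * (norm (z k \<omega> - z0))\<^sup>2 + G\<^sup>2"] assms T_square[OF z_in_Z]
  by (auto simp: prob_space)

lemma noise_second_moment:
  assumes "integrable M (\<lambda>\<omega>. (norm (z k \<omega> - z0))\<^sup>2)"
  shows "integrable M (\<lambda>\<omega>. (norm (noise k \<omega>))\<^sup>2)"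
    and "(\<integral>\<omega>. (norm (noise k \<omega>))\<^sup>2 \<partial>M) \<le> B\<^sup>2 * (\<integral>\<omega>. (norm (z k \<omega> - z0))\<^sup>2 \<partial>M) + G\<^sup>2"
proof -
  have centered: "integrable S (\<lambda>s. (norm (F v - T v s))\<^sup>2)"
    "(\<integral>s. (norm (F v - T v s))\<^sup>2 \<partial>S) \<le> B\<^sup>2 * (norm (v - z0))\<^sup>2 + G\<^sup>2" if "v \<in> Z" for v
    using S.second_moment_centered[OF T_measurable_snd T_square(1)[OF that]] T_square(2)[OF that]
    unfolding F_def by auto
  show "integrable M (\<lambda>\<omega>. (norm (noise k \<omega>))\<^sup>2)"
    and "(\<integral>\<omega>. (norm (noise k \<omega>))\<^sup>2 \<partial>M) \<le> B\<^sup>2 * (\<integral>\<omega>. (norm (z k \<omega> - z0))\<^sup>2 \<partial>M) + G\<^sup>2"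
    using fresh.fresh_nonneg_bound[where k = k and h = "\<lambda>p. (norm (F (fst (fst p)) - T (fst (fst p)) (snd p)))\<^sup>2"
      and c = "\<lambda>\<omega>. B\<^sup>2 * (norm (z k \<omega> - z0))\<^sup>2 + G\<^sup>2"] assms centered[OF z_in_Z]
    by (auto simp: prob_space noise_def)
qed

text \<open>Given the past the noise has mean zero, and an inner product with a function of the past keeps this.\<close>

lemma noise_orthogonal_to_past:
  fixes a :: "'e \<times> 'e \<Rightarrow> 'e"
  assumes a[measurable]: "a \<in> borel_measurable (borel \<Otimes>\<^sub>M borel)"
    and sq: "integrable M (\<lambda>\<omega>. (norm (a (z k \<omega>, noise_sum k \<omega>)))\<^sup>2)"
    and sqz: "integrable M (\<lambda>\<omega>. (norm (z k \<omega> - z0))\<^sup>2)"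
  shows "integrable M (\<lambda>\<omega>. a (z k \<omega>, noise_sum k \<omega>) \<bullet> noise k \<omega>)"
    and "(\<integral>\<omega>. a (z k \<omega>, noise_sum k \<omega>) \<bullet> noise k \<omega> \<partial>M) = 0"
proof -
  show int: "integrable M (\<lambda>\<omega>. a (z k \<omega>, noise_sum k \<omega>) \<bullet> noise k \<omega>)"
    using sq noise_second_moment(1)[OF sqz] by (intro integrable_inner_square) measurable
  have "(\<integral>s. a p \<bullet> (F v - T v s) \<partial>S) = 0" if "v \<in> Z" for p v
  proof -
    have "integrable S (T v)"
      using S.square_integrable_imp_integrable_euclidean[OF T_measurable_snd T_square(1)[OF that]] .
    then show ?thesis by (simp add: F_def inner_diff_right S.prob_space)
  qed
  then show "(\<integral>\<omega>. a (z k \<omega>, noise_sum k \<omega>) \<bullet> noise k \<omega> \<partial>M) = 0"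
    using fresh.integral_fresh[where k = k and h = "\<lambda>p. a (fst p) \<bullet> (F (fst (fst p)) - T (fst (fst p)) (snd p))"]
      int z_in_Z by (simp add: noise_def)
qed

text \<open>The anchor \<open>z0\<close> is a fixed point of the projection, so one step at most doubles the squared distance and adds
  a multiple of the squared oracle value, whose expectation the previous distance controls.\<close>

lemma distance_square_integrable: "integrable M (\<lambda>\<omega>. (norm (z k \<omega> - z0))\<^sup>2)"
proof (induction k)
  case 0
  show ?case by (simp add: z)
next
  case (Suc k)
  let ?b = "anchor_weight k" and ?t = "step_size B k"
  have le: "(norm (z (Suc k) \<omega> - z0))\<^sup>2
      \<le> 2 * (norm (z k \<omega> - z0))\<^sup>2 + 2 * ?t\<^sup>2 * (norm (T (z k \<omega>) (\<xi> k \<omega>)))\<^sup>2" for \<omega>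
  proof -
    let ?d = "z k \<omega> - z0" and ?g = "T (z k \<omega>) (\<xi> k \<omega>)"
    let ?w = "?b *\<^sub>R z0 + (1 - ?b) *\<^sub>R z k \<omega> - ?t *\<^sub>R ?g"
    have "norm (z (Suc k) \<omega> - z0) = dist (closest_point Z ?w) (closest_point Z z0)"
      using Z by (simp add: z closest_point_self dist_norm)
    also have "\<dots> \<le> dist ?w z0"
      by (rule closest_point_lipschitz) (use Z in auto)
    also have "\<dots> = norm ((1 - ?b) *\<^sub>R ?d - ?t *\<^sub>R ?g)"
      by (simp add: dist_norm algebra_simps)
    also have "\<dots> \<le> norm ((1 - ?b) *\<^sub>R ?d) + norm (?t *\<^sub>R ?g)" by (rule norm_triangle_ineq4)
    also have "\<dots> \<le> norm ?d + \<bar>?t\<bar> * norm ?g"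
      using anchor_weight_bounds[of k] by (auto intro!: mult_left_le_one_le)
    finally have "(norm (z (Suc k) \<omega> - z0))\<^sup>2 \<le> (norm ?d + \<bar>?t\<bar> * norm ?g)\<^sup>2"
      by (rule power_mono) simp
    also have "\<dots> \<le> 2 * (norm ?d)\<^sup>2 + 2 * ?t\<^sup>2 * (norm ?g)\<^sup>2"
      using sum_squares_bound[of "norm ?d" "\<bar>?t\<bar> * norm ?g"] by (simp add: power2_sum power_mult_distrib)
    finally show ?thesis .
  qed
  show ?case
  proof (rule Bochner_Integration.integrable_bound)
    show "integrable M (\<lambda>\<omega>. 2 * (norm (z k \<omega> - z0))\<^sup>2 + 2 * ?t\<^sup>2 * (norm (T (z k \<omega>) (\<xi> k \<omega>)))\<^sup>2)"
      using Suc oracle_second_moment(1)[OF Suc] by simp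
  qed (use le in \<open>auto\<close>)
qed

abbreviation mean_square_distance :: "nat \<Rightarrow> real" where
  "mean_square_distance k \<equiv> (\<integral>\<omega>. (norm (z k \<omega> - z0))\<^sup>2 \<partial>M)"

lemma noise_sum_second_moment:
  "integrable M (\<lambda>\<omega>. (norm (noise_sum k \<omega>))\<^sup>2) \<and>
   (\<integral>\<omega>. (norm (noise_sum k \<omega>))\<^sup>2 \<partial>M) \<le> (\<Sum>i<k. (step_size B i)\<^sup>2 * (B\<^sup>2 * mean_square_distance i + G\<^sup>2))"
proof (induction k)
  case 0
  show ?case by (simp add: noise_sum_def)
next
  case (Suc k)
  let ?t = "step_size B k"
  have expand: "(norm (noise_sum (Suc k) \<omega>))\<^sup>2 = (norm (noise_sum k \<omega>))\<^sup>2
      + 2 * ?t * (noise_sum k \<omega> \<bullet> noise k \<omega>) + ?t\<^sup>2 * (norm (noise k \<omega>))\<^sup>2" for \<omega>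
  proof -
    have "noise_sum (Suc k) \<omega> = noise_sum k \<omega> + ?t *\<^sub>R noise k \<omega>" by (simp add: noise_sum_def)
    then show ?thesis unfolding power2_norm_eq_inner
      by (simp add: algebra_simps inner_commute power2_eq_square)
  qed
  note sqz = distance_square_integrable[of k]
  note cross = noise_orthogonal_to_past[of snd, OF measurable_snd _ sqz, simplified, OF conjunct1[OF Suc]]
  note sq = noise_second_moment[OF sqz]
  have "?t\<^sup>2 * (\<integral>\<omega>. (norm (noise k \<omega>))\<^sup>2 \<partial>M) \<le> ?t\<^sup>2 * (B\<^sup>2 * mean_square_distance k + G\<^sup>2)"
    by (rule mult_left_mono[OF sq(2)]) simp
  then show ?case unfolding expand using Suc cross sq(1) by simp
qed

text \<open>The oracle terms contribute \<open>\<tau>\<^sub>i\<^sup>2 (norm T\<^sub>i)\<^sup>2\<close> and the noise sum another quarter of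
  this, so the growth terms are \<open>5 / 4 * \<tau>\<^sub>i\<^sup>2 B\<^sup>2 = \<beta>\<^sub>i / 20\<close> times the mean square distance at time \<open>i\<close>. The
  anchoring provides \<open>- \<beta>\<^sub>i / 2\<close> times the one at time \<open>i + 1\<close>; as the weights decrease and the distance
  at time \<open>0\<close> vanishes, shifting the index makes the sum nonpositive.\<close>

lemma gap_majorant:
  assumes D: "0 \<le> D"
  shows "\<exists>R. integrable M R \<and>
    (\<integral>\<omega>. R \<omega> \<partial>M) \<le> (3 + ln (real k + 1)) / 2 * D + (\<Sum>i<k. 5 * (step_size B i)\<^sup>2 * G\<^sup>2) \<and>
    (\<forall>\<omega>. \<forall>u\<in>Z. (norm (u - z0))\<^sup>2 \<le> D \<longrightarrow>
      (\<Sum>i<k. step_size B i * (F (z i \<omega>) \<bullet> (z i \<omega> - u))) \<le> R \<omega>)"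
proof -
  let ?b = anchor_weight and ?t = "step_size B"
  define R where "R \<omega> = (3 + (\<Sum>i<k. ?b i)) / 2 * D - (\<Sum>i<k. ?b i * (norm (z (Suc i) \<omega> - z0))\<^sup>2) / 2
      + (\<Sum>i<k. (?t i)\<^sup>2 * (norm (T (z i \<omega>) (\<xi> i \<omega>)))\<^sup>2)
      + (\<Sum>i<k. ?t i * ((z i \<omega> - z0) \<bullet> noise i \<omega>))
      + (norm (noise_sum k \<omega>))\<^sup>2 / 4" for \<omega>
  have major: "(\<Sum>i<k. ?t i * (F (z i \<omega>) \<bullet> (z i \<omega> - u))) \<le> R \<omega>"
    if "u \<in> Z" "(norm (u - z0))\<^sup>2 \<le> D" for \<omega> u
    unfolding R_def noise_def noise_sum_def
    by (rule anchored_projection_uniform_bound[where v = "\<lambda>i. z i \<omega>" and b = ?b and Z = Z])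
      (use Z that anchor_weight_bounds in \<open>auto simp: z\<close>)
  note sqz = distance_square_integrable
  note orac = oracle_second_moment[OF sqz]
  note cross = noise_orthogonal_to_past[of "\<lambda>p. fst p - z0", OF _ _ sqz, simplified, OF sqz]
  note ns = noise_sum_second_moment[of k]
  have int: "integrable M R"
    unfolding R_def using sqz orac(1) cross(1) ns by simp
  have "(\<integral>\<omega>. R \<omega> \<partial>M) = (3 + (\<Sum>i<k. ?b i)) / 2 * D - (\<Sum>i<k. ?b i * mean_square_distance (Suc i)) / 2
      + (\<Sum>i<k. (?t i)\<^sup>2 * (\<integral>\<omega>. (norm (T (z i \<omega>) (\<xi> i \<omega>)))\<^sup>2 \<partial>M))
      + (\<integral>\<omega>. (norm (noise_sum k \<omega>))\<^sup>2 \<partial>M) / 4"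
    unfolding R_def using sqz orac(1) cross ns by (simp add: prob_space)
  also have "\<dots> \<le> (3 + (\<Sum>i<k. ?b i)) / 2 * D - (\<Sum>i<k. ?b i * mean_square_distance (Suc i)) / 2
      + 5 / 4 * (\<Sum>i<k. (?t i)\<^sup>2 * (B\<^sup>2 * mean_square_distance i + G\<^sup>2))"
  proof -
    have "(\<Sum>i<k. (?t i)\<^sup>2 * (\<integral>\<omega>. (norm (T (z i \<omega>) (\<xi> i \<omega>)))\<^sup>2 \<partial>M))
        \<le> (\<Sum>i<k. (?t i)\<^sup>2 * (B\<^sup>2 * mean_square_distance i + G\<^sup>2))"
      by (intro sum_mono mult_left_mono orac(2)) simp
    then show ?thesis using ns by simp
  qed
  also have "5 / 4 * (\<Sum>i<k. (?t i)\<^sup>2 * (B\<^sup>2 * mean_square_distance i + G\<^sup>2))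
      = (\<Sum>i<k. ?b i * mean_square_distance i) / 20 + (\<Sum>i<k. 5 / 4 * (?t i)\<^sup>2 * G\<^sup>2)"
  proof -
    have "(?t i)\<^sup>2 * (B\<^sup>2 * mean_square_distance i + G\<^sup>2) = ?b i * mean_square_distance i / 25 + (?t i)\<^sup>2 * G\<^sup>2" for i
      using step_size_square[OF B, of i] by (simp add: distrib_left mult.assoc[symmetric])
    then show ?thesis 
      unfolding sum_distrib_left sum_divide_distrib sum.distrib[symmetric]
      by (intro sum.cong refl) simp
  qed
  also have "(3 + (\<Sum>i<k. ?b i)) / 2 * D - (\<Sum>i<k. ?b i * mean_square_distance (Suc i)) / 2
      + ((\<Sum>i<k. ?b i * mean_square_distance i) / 20 + (\<Sum>i<k. 5 / 4 * (?t i)\<^sup>2 * G\<^sup>2))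
    \<le> (3 + ln (real k + 1)) / 2 * D + (\<Sum>i<k. 5 * (?t i)\<^sup>2 * G\<^sup>2)"
  proof -
    have "(\<Sum>i<k. ?b i * mean_square_distance i) \<le> (\<Sum>i<Suc k. ?b i * mean_square_distance i)"
      by (simp add: anchor_weight_bounds)
    also have "\<dots> = (\<Sum>i<k. ?b (Suc i) * mean_square_distance (Suc i))"
      by (subst sum.lessThan_Suc_shift) (simp add: z)
    also have "\<dots> \<le> (\<Sum>i<k. ?b i * mean_square_distance (Suc i))"
      by (intro sum_mono mult_right_mono anchor_weight_decreasing) simp
    finally have "(\<Sum>i<k. ?b i * mean_square_distance i) \<le> (\<Sum>i<k. ?b i * mean_square_distance (Suc i))" .
    moreover have "0 \<le> (\<Sum>i<k. ?b i * mean_square_distance i)"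
      by (intro sum_nonneg mult_nonneg_nonneg anchor_weight_bounds) simp
    moreover have "(\<Sum>i<k. 5 / 4 * (?t i)\<^sup>2 * G\<^sup>2) \<le> (\<Sum>i<k. 5 * (?t i)\<^sup>2 * G\<^sup>2)"
      by (intro sum_mono mult_right_mono) simp_all
    moreover have "(3 + (\<Sum>i<k. ?b i)) / 2 * D \<le> (3 + ln (real k + 1)) / 2 * D"
      using D sum_anchor_weight_le_ln[of k] by (intro mult_right_mono) auto
    ultimately show ?thesis by linarith
  qed
  finally show ?thesis using int major by blast
qed

end

section \<open>From the operator gap to the Lagrangian\<close>

lemma mem_primal_dual_set: "(x, y) \<in> primal_dual_set \<longleftrightarrow> (\<forall>i. 0 \<le> y $ i)"
  by (simp add: primal_dual_set_def)

lemma convex_primal_dual_set: "convex primal_dual_set"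
  unfolding primal_dual_set_def
  by (intro convex_Times) (auto simp: convex_def)

lemma closed_primal_dual_set: "closed (primal_dual_set :: ((real ^ 'd) \<times> (real ^ 'n)) set)"
proof -
  have "{y :: real ^ 'n. \<forall>i. 0 \<le> y $ i} = (\<Inter>i. {y. 0 \<le> y $ i})" by auto
  moreover have "closed \<dots>" by (intro closed_INT ballI closed_Collect_le continuous_intros)
  ultimately show ?thesis unfolding primal_dual_set_def
    by (simp only: closed_Times closed_UNIV)
qed

lemma lagrangian_zero: "lagrangian f g x 0 = f x"
  by (simp add: lagrangian_def)

lemma lagrangian_add: "lagrangian f g x (y + y') = lagrangian f g x y + (\<Sum>i\<in>UNIV. y' $ i * g i x)"
  by (simp add: lagrangian_def algebra_simps sum.distrib)

lemma lagrangian_scaleR: "lagrangian f g x (c *\<^sub>R y) = f x + c * (lagrangian f g x y - f x)"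
  by (simp add: lagrangian_def sum_distrib_left mult.assoc)

text \<open>Testing the dual optimality of \<open>ys\<close> at \<open>0\<close> and \<open>2 ys\<close> gives complementary slackness.\<close>

lemma saddle_point_value:
  assumes "saddle_point f g xs ys"
  shows "lagrangian f g xs ys = f xs"
    and "\<And>y. (\<And>i. 0 \<le> y $ i) \<Longrightarrow> lagrangian f g xs y \<le> f xs"
    and "\<And>x. f xs \<le> lagrangian f g x ys"
proof -
  have ys: "0 \<le> ys $ i" for i
    using assms by (simp add: saddle_point_def mem_primal_dual_set)
  have le: "lagrangian f g xs y \<le> lagrangian f g xs ys" "lagrangian f g xs ys \<le> lagrangian f g x ys"
    if "\<And>i. 0 \<le> y $ i" for x y
  proof -
    have "(x, y) \<in> primal_dual_set" using that by (simp add: mem_primal_dual_set)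
    then show "lagrangian f g xs y \<le> lagrangian f g xs ys" "lagrangian f g xs ys \<le> lagrangian f g x ys"
      using assms unfolding saddle_point_def by fast+
  qed
  have "f xs \<le> lagrangian f g xs ys" using le(1)[of 0] by (simp add: lagrangian_zero)
  moreover have "lagrangian f g xs ys \<le> f xs"
    using le(1)[of "2 *\<^sub>R ys"] ys by (simp add: lagrangian_scaleR)
  ultimately show eq: "lagrangian f g xs ys = f xs" by simp
  show "lagrangian f g xs y \<le> f xs" if "\<And>i. 0 \<le> y $ i" for y using le(1)[OF that] eq by simp
  show "f xs \<le> lagrangian f g x ys" for x using le(2)[OF ys] eq by simp
qed

text \<open>The primal component gives the subgradient inequalities of \<open>f\<close> and, weighted by \<open>y \<ge> 0\<close>, of the constraints;
  the dual component is linear, so it contributes an equality.\<close>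

lemma mean_operator_gap:
  fixes f :: "real ^ 'd \<Rightarrow> real" and g :: "'n::finite \<Rightarrow> real ^ 'd \<Rightarrow> real"
  assumes P: "prob_space P" and y: "\<And>i. 0 \<le> y $ i"
    and nf: "integrable P (nf x)" "(\<integral>w. nf x w \<partial>P) \<in> subdifferential f x"
    and ng: "\<And>i. integrable P (ng i x)" "\<And>i. (\<integral>w. ng i x w \<partial>P) \<in> subdifferential (g i) x"
    and gt: "\<And>i. integrable P (gt i x)" "\<And>i. (\<integral>w. gt i x w \<partial>P) = g i x"
  shows "lagrangian f g x y' - lagrangian f g x' y
    \<le> mean_operator P nf ng gt (x, y) \<bullet> ((x, y) - (x', y'))"
proof -
  define p q where "p = (\<integral>w. nf x w \<partial>P)" and "q i = (\<integral>w. ng i x w \<partial>P)" for i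
  have p: "f x - f x' \<le> p \<bullet> (x - x')"
    using nf(2) by (auto simp: p_def subdifferential_def inner_diff_right dest!: spec[of _ x'])
  have q: "g i x - g i x' \<le> q i \<bullet> (x - x')" for i
    using ng(2)[of i] by (auto simp: q_def subdifferential_def inner_diff_right dest!: spec[of _ x'])
  have "(\<Sum>i\<in>UNIV. y $ i * (g i x - g i x')) \<le> (\<Sum>i\<in>UNIV. y $ i * (q i \<bullet> (x - x')))"
    by (intro sum_mono mult_left_mono q y)
  moreover have "mean_operator P nf ng gt (x, y) \<bullet> ((x, y) - (x', y'))
      = p \<bullet> (x - x') + (\<Sum>i\<in>UNIV. y $ i * (q i \<bullet> (x - x'))) - (\<Sum>i\<in>UNIV. g i x * (y $ i - y' $ i))"
    using mean_operator_eq[where nf = nf and ng = ng and gt = gt and x = x and y = y, OF P nf(1) ng(1) gt(1)]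
    by (simp add: p_def[symmetric] q_def[symmetric] gt(2) inner_add_left inner_sum_left)
      (simp add: inner_vec_def)
  ultimately show ?thesis using p
    by (simp add: lagrangian_def sum_subtractf right_diff_distrib mult.commute)
qed

lemma convex_on_lagrangian:
  fixes f :: "real ^ 'd \<Rightarrow> real" and g :: "'n::finite \<Rightarrow> real ^ 'd \<Rightarrow> real"
  assumes "convex_on UNIV f" "\<And>i. convex_on UNIV (g i)" and y: "\<And>i. 0 \<le> y $ i"
  shows "convex_on UNIV (\<lambda>x. lagrangian f g x y)"
proof -
  have "convex_on UNIV (\<lambda>x. \<Sum>i\<in>A. y $ i * g i x)" if "finite A" for A
    using that
  proof induction
    case (insert i A)
    then show ?case using assms(2)[of i] y[of i]
      by (auto intro!: convex_on_add convex_on_cmul)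
  qed (simp add: convex_on_const)
  then show ?thesis using assms(1) unfolding lagrangian_def by (intro convex_on_add) auto
qed

lemma step_size_pos: "0 < B \<Longrightarrow> 0 < step_size B k"
  by (simp add: step_size_def)

lemma sum_step_size_pos: "0 < B \<Longrightarrow> 1 \<le> k \<Longrightarrow> 0 < (\<Sum>i<k. step_size B i)"
  by (intro sum_pos step_size_pos) (auto simp: lessThan_empty_iff)

lemma averaged_iterate_jensen:
  fixes x :: "nat \<Rightarrow> 'v::real_vector"
  assumes h: "convex_on UNIV h" and B: "0 < B" and k: "1 \<le> k"
  shows "(\<Sum>i<k. step_size B i) * h (averaged_iterate B x k) \<le> (\<Sum>i<k. step_size B i * h (x i))"
proof -
  let ?S = "\<Sum>i<k. step_size B i"
  have S: "0 < ?S" by (rule sum_step_size_pos[OF B k])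
  have "h (\<Sum>i<k. (step_size B i / ?S) *\<^sub>R x i) \<le> (\<Sum>i<k. step_size B i / ?S * h (x i))"
    by (rule convex_on_sum[OF _ _ h])
      (use S k step_size_pos[OF B] in \<open>auto simp: sum_divide_distrib[symmetric] less_imp_le\<close>)
  also have "(\<Sum>i<k. (step_size B i / ?S) *\<^sub>R x i) = averaged_iterate B x k"
    by (simp add: averaged_iterate_def scaleR_right.sum)
  also have "(\<Sum>i<k. step_size B i / ?S * h (x i)) = (\<Sum>i<k. step_size B i * h (x i)) / ?S"
    by (simp add: sum_divide_distrib)
  finally show ?thesis using S by (simp add: field_simps)
qed

text \<open>The gap at \<open>0\<close> is \<open>f x - f xs\<close>. For the opposite sign, \<open>L(x, ys) \<ge> f xs\<close> and the gap at \<open>2 ys\<close> is twice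
  the (nonnegative) gap at \<open>ys\<close> minus \<open>f x - f xs\<close>.\<close>

lemma objective_error_le_gap:
  assumes saddle: "saddle_point f g xs ys"
    and gap: "\<And>y. y \<in> {0, 2 *\<^sub>R ys} \<Longrightarrow> lagrangian f g x y - f xs \<le> r"
  shows "\<bar>f x - f xs\<bar> \<le> r"
  using saddle_point_value(3)[OF saddle, of x] gap[of 0] gap[of "2 *\<^sub>R ys"]
  by (simp add: lagrangian_zero lagrangian_scaleR)

text \<open>The indicator picks up exactly the positive parts, and the gap at \<open>ys\<close> itself is nonnegative.\<close>

lemma constraint_violation_le_gap:
  assumes saddle: "saddle_point f g xs ys"
    and gap: "lagrangian f g x (ys + (\<chi> i. if 0 < g i x then 1 else 0)) - f xs \<le> r"
  shows "(\<Sum>i\<in>UNIV. max 0 (g i x)) \<le> r"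
proof -
  have "(\<Sum>i\<in>UNIV. max 0 (g i x)) = (\<Sum>i\<in>UNIV. (\<chi> i. if 0 < g i x then 1 else 0) $ i * g i x)"
    by (intro sum.cong) (auto simp: max_def)
  then show ?thesis using gap saddle_point_value(3)[OF saddle, of x] by (simp add: lagrangian_add)
qed

lemma norm_doubled_dual_le:
  fixes ys y0 :: "'v::real_inner"
  shows "(norm (2 *\<^sub>R ys - y0))\<^sup>2 \<le> 2 * ((norm (ys - y0))\<^sup>2 + (norm ys)\<^sup>2)"
proof -
  have "2 * ((norm (ys - y0))\<^sup>2 + (norm ys)\<^sup>2) - (norm (2 *\<^sub>R ys - y0))\<^sup>2 = (norm y0)\<^sup>2"
    unfolding power2_norm_eq_inner by (simp add: algebra_simps inner_commute)
  then show ?thesis using zero_le_power2[of "norm y0"] by linarith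
qed

text \<open>In a coordinate where the indicator vanishes, adding \<open>1\<close> increases \<open>\<bar>ys - y0\<bar>\<close> unless \<open>ys < y0\<close>, and in
  that case \<open>\<bar>ys - y0\<bar> \<le> y0\<close>. This is the origin of the term \<open>(norm y0)\<^sup>2\<close> in the constant for the constraint
  violation.\<close>

lemma norm_indicator_dual_le:
  fixes ys y0 :: "real ^ 'n::finite"
  assumes ys: "\<And>i. 0 \<le> ys $ i" and y0: "\<And>i. 0 \<le> y0 $ i"
  shows "(norm (ys + (\<chi> i. if Q i then 1 else 0) - y0))\<^sup>2 \<le> (norm (ys + (\<chi> i. 1) - y0))\<^sup>2 + (norm y0)\<^sup>2"
proof -
  have coord: "(a + (if q then 1 else 0) - c)\<^sup>2 \<le> (a + 1 - c)\<^sup>2 + c\<^sup>2"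
    if "0 \<le> a" "0 \<le> c" for a c :: real and q
  proof (cases q)
    case False
    have "(a - c)\<^sup>2 \<le> (a + 1 - c)\<^sup>2 + c\<^sup>2"
    proof (cases "c \<le> a")
      case True
      then have "(a - c)\<^sup>2 \<le> (a + 1 - c)\<^sup>2" by (intro power_mono) auto
      then show ?thesis using zero_le_power2[of c] by linarith
    next
      case False
      then have "(c - a)\<^sup>2 \<le> c\<^sup>2" using that by (intro power_mono) auto
      then show ?thesis using zero_le_power2[of "a + 1 - c"] power2_commute[of a c] by linarith
    qed
    with \<open>\<not> q\<close> show ?thesis by simp
  qed simp
  have norm_sq: "(norm v)\<^sup>2 = (\<Sum>i\<in>UNIV. (v $ i)\<^sup>2)" for v :: "real ^ 'n"
    unfolding power2_norm_eq_inner by (simp add: inner_vec_def power2_eq_square)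
  show ?thesis unfolding norm_sq sum.distrib[symmetric]
    by (intro sum_mono) (use coord[OF ys y0] in simp)
qed

section \<open>Growth of the rate bound\<close>

lemma sum_step_size_ge:
  assumes B: "0 < B"
  shows "real k / (5 * B * sqrt (real k + 1)) \<le> (\<Sum>i<k. step_size B i)"
proof -
  have "1 / (5 * B * sqrt (real k + 1)) \<le> step_size B i" if "i < k" for i
    unfolding step_size_def using that B by (intro divide_left_mono mult_left_mono) auto
  then have "(\<Sum>i<k. 1 / (5 * B * sqrt (real k + 1))) \<le> (\<Sum>i<k. step_size B i)"
    by (intro sum_mono) auto
  then show ?thesis by simp
qed

text \<open>The sum of the step sizes grows like \<open>sqrt k\<close> and the numerator at most like \<open>ln k\<close>; one logarithmic factor
  suffices.\<close>

lemma rate_bound_soft_bigo: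
  assumes B: "0 < B" and D: "0 \<le> D"
  shows "rate_bound B G x0 y0 D \<in> soft_bigo (\<lambda>k. 1 / sqrt (real k))"
proof -
  define c where "c = (norm x0)\<^sup>2 + (norm y0)\<^sup>2"
  \<comment> \<open>The factor \<open>10 * B\<close> comes from the step sizes summing to at least \<open>sqrt k / (10 * B)\<close>; the bracket collects
    the numerator after its constants have been multiplied by \<open>ln k\<close>, which is at least \<open>1\<close> for \<open>k \<ge> 3\<close>.\<close>
  define C where "C = 10 * B * (5 / 2 * D + c + 2 * G\<^sup>2 / (5 * B\<^sup>2))"
  have c: "0 \<le> c" by (simp add: c_def)
  have "rate_bound B G x0 y0 D \<in> O(\<lambda>k. ln (real k) ^ 1 * (1 / sqrt (real k)))"
  proof (rule bigoI[where c = C], rule eventually_mono[OF eventually_ge_at_top[of 3]])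
    fix k :: nat
    assume k: "3 \<le> k"
    have "exp (1::real) \<le> 3" by (rule exp_le)
    also have "(3::real) \<le> real k" using k by simp
    finally have ln1: "1 \<le> ln (real k)" using k by (subst ln_ge_iff) auto
    have "ln (real k + 1) \<le> ln (real k ^ 2)"
    proof (subst ln_le_cancel_iff)
      have "3 * real k \<le> real k * real k" using k by (intro mult_right_mono) auto
      then show "real k + 1 \<le> real k ^ 2" using k unfolding power2_eq_square by linarith
    qed (use k in auto)
    also have "\<dots> = 2 * ln (real k)" using k by (simp add: ln_realpow)
    finally have ln2: "ln (real k + 1) \<le> 2 * ln (real k)" .
    have "(\<Sum>i<k. 5 * (step_size B i)\<^sup>2 * G\<^sup>2) = (\<Sum>i<k. G\<^sup>2 / (5 * B\<^sup>2) * anchor_weight i)"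
    proof (intro sum.cong refl)
      fix i
      have "(step_size B i)\<^sup>2 = anchor_weight i / (25 * B\<^sup>2)"
        using step_size_square[OF B, of i] B by (simp add: field_simps)
      then show "5 * (step_size B i)\<^sup>2 * G\<^sup>2 = G\<^sup>2 / (5 * B\<^sup>2) * anchor_weight i"
        by simp
    qed
    also have "\<dots> = G\<^sup>2 / (5 * B\<^sup>2) * (\<Sum>i<k. anchor_weight i)" by (simp add: sum_distrib_left)
    also have "\<dots> \<le> G\<^sup>2 / (5 * B\<^sup>2) * (2 * ln (real k))"
      using sum_anchor_weight_le_ln[of k] ln2 by (intro mult_left_mono) auto
    finally have noise: "(\<Sum>i<k. 5 * (step_size B i)\<^sup>2 * G\<^sup>2) \<le> 2 * G\<^sup>2 / (5 * B\<^sup>2) * ln (real k)" by simp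
    have "(3 + ln (real k + 1)) / 2 * D \<le> (5 / 2 * ln (real k)) * D"
      using ln1 ln2 D by (intro mult_right_mono) auto
    moreover have "c \<le> c * ln (real k)" using c ln1 by (simp add: mult_le_cancel_left1)
    ultimately have num: "(3 + ln (real k + 1)) / 2 * D + c + (\<Sum>i<k. 5 * (step_size B i)\<^sup>2 * G\<^sup>2)
        \<le> C / (10 * B) * ln (real k)" (is "?num \<le> _")
    proof -
      have "C / (10 * B) = 5 / 2 * D + c + 2 * G\<^sup>2 / (5 * B\<^sup>2)" using B by (simp add: C_def)
      then have "C / (10 * B) * ln (real k)
          = 5 / 2 * ln (real k) * D + c * ln (real k) + 2 * G\<^sup>2 / (5 * B\<^sup>2) * ln (real k)"
        by (simp only: distrib_left distrib_right mult_ac)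
      with \<open>(3 + ln (real k + 1)) / 2 * D \<le> _\<close> \<open>c \<le> _\<close> noise show ?thesis by linarith
    qed
    have num0: "0 \<le> ?num"
      using D c ln1 ln2 by (intro add_nonneg_nonneg sum_nonneg mult_nonneg_nonneg) auto
    let ?S = "\<Sum>i<k. step_size B i"
    have S: "0 < ?S" using k by (intro sum_step_size_pos B) auto
    have "sqrt (real k) / (10 * B) \<le> real k / (5 * B * sqrt (real k + 1))"
    proof -
      have "sqrt (real k) * sqrt (real k + 1) \<le> sqrt (real k) * (2 * sqrt (real k))"
        using k by (intro mult_left_mono real_le_lsqrt) (auto simp: power_mult_distrib)
      also have "\<dots> = 2 * real k" by simp
      finally show ?thesis using B by (simp add: field_simps)
    qed
    also have "\<dots> \<le> ?S" by (rule sum_step_size_ge[OF B])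
    finally have "1 / ?S \<le> 1 / (sqrt (real k) / (10 * B))"
      using B k S by (intro divide_left_mono mult_pos_pos) auto
    then have "1 / ?S * ?num \<le> (10 * B / sqrt (real k)) * (C / (10 * B) * ln (real k))"
      using num num0 B by (intro mult_mono) auto
    also have "\<dots> = C * (ln (real k) ^ 1 * (1 / sqrt (real k)))" using B by simp
    also have "\<dots> = C * norm (ln (real k) ^ 1 * (1 / sqrt (real k)))" using ln1 by simp
    finally have "1 / ?S * ?num \<le> C * norm (ln (real k) ^ 1 * (1 / sqrt (real k)))" .
    moreover have "rate_bound B G x0 y0 D k = 1 / ?S * ?num"
      by (simp add: rate_bound_def c_def add.assoc)
    moreover have "0 \<le> 1 / ?S * ?num" using num0 S by (intro mult_nonneg_nonneg) auto
    ultimately show "norm (rate_bound B G x0 y0 D k) \<le> C * norm (ln (real k) ^ 1 * (1 / sqrt (real k)))"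
      by simp
  qed
  then show ?thesis unfolding soft_bigo_def by blast
qed

section \<open>Convergence of objective and feasibility\<close>

text \<open>The sampled index takes finitely many values, so joint measurability can be checked for each fixed index.\<close>

lemma stoch_operator_measurable:
  fixes ng :: "'n::finite \<Rightarrow> real ^ 'd \<Rightarrow> 'w \<Rightarrow> real ^ 'd"
  assumes nf: "(\<lambda>(x, w). nf x w) \<in> borel_measurable (borel \<Otimes>\<^sub>M P)"
    and ng: "\<And>i. (\<lambda>(x, w). ng i x w) \<in> borel_measurable (borel \<Otimes>\<^sub>M P)"
    and gt: "\<And>i. (\<lambda>(x, w). gt i x w) \<in> borel_measurable (borel \<Otimes>\<^sub>M P)"
  shows "case_prod (stoch_operator nf ng gt) \<in> borel_measurable (borel \<Otimes>\<^sub>M sample_measure P)"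
proof -
  let ?A = "(borel :: ((real ^ 'd) \<times> (real ^ 'n)) measure) \<Otimes>\<^sub>M sample_measure P"
  have "fst \<in> sample_measure P \<rightarrow>\<^sub>M P" unfolding sample_measure_def by simp
  then have w[measurable]: "(\<lambda>p. fst (snd p)) \<in> ?A \<rightarrow>\<^sub>M P" by measurable
  have "snd \<in> sample_measure P \<rightarrow>\<^sub>M count_space (UNIV :: 'n set)"
    unfolding sample_measure_def
    by (subst measurable_cong_sets[OF refl sets_uniform_count_measure_count_space[symmetric]]) simp
  then have i: "(\<lambda>p. snd (snd p)) \<in> ?A \<rightarrow>\<^sub>M count_space (UNIV :: 'n set)" by measurable
  have x[measurable]: "(\<lambda>p. fst (fst p)) \<in> borel_measurable ?A"
    by (rule measurable_compose[OF measurable_fst]) (auto intro!: borel_measurable_continuous_onI continuous_intros)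
  have y[measurable]: "(\<lambda>p. snd (fst p) $ i) \<in> borel_measurable ?A" for i
    by (rule measurable_compose[OF measurable_fst]) (auto intro!: borel_measurable_continuous_onI continuous_intros)
  have [measurable]: "(\<lambda>p. nf (fst (fst p)) (fst (snd p))) \<in> borel_measurable ?A"
    "(\<lambda>p. ng i (fst (fst p)) (fst (snd p))) \<in> borel_measurable ?A"
    "(\<lambda>p. gt i (fst (fst p)) (fst (snd p))) \<in> borel_measurable ?A" for i
    using measurable_compose[OF measurable_Pair[OF x w] nf] measurable_compose[OF measurable_Pair[OF x w] ng[of i]]
      measurable_compose[OF measurable_Pair[OF x w] gt[of i]] by simp_all
  have "(\<lambda>p. stoch_operator nf ng gt (fst p) (fst (snd p), snd (snd p))) \<in> borel_measurable ?A"
  proof (rule measurable_compose_countable[OF _ i])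
    fix i :: 'n
    have "(\<lambda>p. (nf (fst (fst p)) (fst (snd p)) + (real CARD('n) * snd (fst p) $ i) *\<^sub>R ng i (fst (fst p)) (fst (snd p)),
        - ((real CARD('n) * gt i (fst (fst p)) (fst (snd p))) *\<^sub>R (axis i 1 :: real ^ 'n)))) \<in> borel_measurable ?A"
      by measurable
    then show "(\<lambda>p. stoch_operator nf ng gt (fst p) (fst (snd p), i)) \<in> borel_measurable ?A"
      by (simp add: stoch_operator_def case_prod_beta)
  qed
  then show ?thesis by (simp add: case_prod_beta)
qed

theorem proposition4p2:
  fixes f :: "real ^ 'd \<Rightarrow> real"
    and g :: "'n::finite \<Rightarrow> real ^ 'd \<Rightarrow> real"
    and P :: "'w measure"
    and nf :: "real ^ 'd \<Rightarrow> 'w \<Rightarrow> real ^ 'd"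
    and ng :: "'n \<Rightarrow> real ^ 'd \<Rightarrow> 'w \<Rightarrow> real ^ 'd"
    and gt :: "'n \<Rightarrow> real ^ 'd \<Rightarrow> 'w \<Rightarrow> real"
    and B G :: real
    and x0 xs :: "real ^ 'd" and y0 ys :: "real ^ 'n"
    and M :: "'a measure"
    and \<xi> :: "nat \<Rightarrow> 'a \<Rightarrow> 'w \<times> 'n"
    and z :: "nat \<Rightarrow> 'a \<Rightarrow> (real ^ 'd) \<times> (real ^ 'n)"
  assumes "convex_on UNIV f" and "\<And>i. convex_on UNIV (g i)"
    and "saddle_point f g xs ys"
    and "prob_space P"
    and "(\<lambda>(x, w). nf x w) \<in> borel_measurable (borel \<Otimes>\<^sub>M P)"
    and "\<And>i. (\<lambda>(x, w). ng i x w) \<in> borel_measurable (borel \<Otimes>\<^sub>M P)"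
    and "\<And>i. (\<lambda>(x, w). gt i x w) \<in> borel_measurable (borel \<Otimes>\<^sub>M P)"
    and "\<And>x. integrable P (nf x) \<and> (\<integral>w. nf x w \<partial>P) \<in> subdifferential f x"
    and "\<And>i x. integrable P (ng i x) \<and> (\<integral>w. ng i x w \<partial>P) \<in> subdifferential (g i) x"
    and "\<And>i x. integrable P (gt i x) \<and> (\<integral>w. gt i x w \<partial>P) = g i x"
    and "0 < B" and "0 \<le> G"
    and "(x0, y0) \<in> primal_dual_set"
    and "\<And>v. v \<in> primal_dual_set \<Longrightarrow>
          integrable (sample_measure P) (\<lambda>s. (norm (stoch_operator nf ng gt v s))\<^sup>2) \<and>
          (\<integral>s. (norm (stoch_operator nf ng gt v s))\<^sup>2 \<partial>sample_measure P)
            \<le> B\<^sup>2 * (norm (v - (x0, y0)))\<^sup>2 + G\<^sup>2"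
    and "prob_space M"
    and "prob_space.indep_vars M (\<lambda>_. sample_measure P) \<xi> UNIV"
    and "\<And>k. distr M (sample_measure P) (\<xi> k) = sample_measure P"
    and "\<And>\<omega>. z 0 \<omega> = (x0, y0)"
    and "\<And>k \<omega>. z (Suc k) \<omega> = closest_point primal_dual_set
          (anchor_weight k *\<^sub>R (x0, y0) + (1 - anchor_weight k) *\<^sub>R z k \<omega>
            - step_size B k *\<^sub>R stoch_operator nf ng gt (z k \<omega>) (\<xi> k \<omega>))"
  defines "xout \<equiv> \<lambda>k \<omega>. averaged_iterate B (\<lambda>i. fst (z i \<omega>)) k"
    and "D1 \<equiv> (norm (xs - x0))\<^sup>2 + 2 * ((norm (ys - y0))\<^sup>2 + (norm ys)\<^sup>2) + (norm y0)\<^sup>2"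
    and "D2 \<equiv> (norm (xs - x0))\<^sup>2 + (norm (ys + (\<chi> i. 1) - y0))\<^sup>2 + (norm y0)\<^sup>2"
  shows "(\<forall>k\<ge>1.
           integrable M (\<lambda>\<omega>. \<bar>f (xout k \<omega>) - f xs\<bar>) \<and>
           (\<integral>\<omega>. \<bar>f (xout k \<omega>) - f xs\<bar> \<partial>M) \<le> rate_bound B G x0 y0 D1 k) \<and>
         rate_bound B G x0 y0 D1 \<in> soft_bigo (\<lambda>k. 1 / sqrt (real k)) \<and>
         (\<forall>k\<ge>1.
           (\<forall>i. integrable M (\<lambda>\<omega>. max 0 (g i (xout k \<omega>)))) \<and>
           (\<Sum>i\<in>UNIV. \<integral>\<omega>. max 0 (g i (xout k \<omega>)) \<partial>M) \<le> rate_bound B G x0 y0 D2 k) \<and>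
         rate_bound B G x0 y0 D2 \<in> soft_bigo (\<lambda>k. 1 / sqrt (real k))"
proof -
  let ?T = "stoch_operator nf ng gt" and ?S = "sample_measure P"
  have P: "prob_space P" by fact
  have "prob_space ?S"
    unfolding sample_measure_def using P
    by (intro prob_space_pair prob_space_uniform_count_measure) auto
  interpret anchored_stochastic_recursion M primal_dual_set ?S ?T \<xi> z "(x0, y0)" B G
    by (intro anchored_stochastic_recursion.intro anchored_stochastic_recursion_axioms.intro)
      (use assms \<open>prob_space ?S\<close> convex_primal_dual_set closed_primal_dual_set
        stoch_operator_measurable[of nf P ng gt] in auto)
  have F: "F v = mean_operator P nf ng gt v" for v
    by (simp add: F_def mean_operator_def)
  have y0: "0 \<le> y0 $ i" and ys: "0 \<le> ys $ i" for i
    using assms by (auto simp: saddle_point_def mem_primal_dual_set)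
  note saddle = \<open>saddle_point f g xs ys\<close>

  have D_nonneg: "0 \<le> D1" "0 \<le> D2" by (simp_all add: D1_def D2_def)

  \<comment> \<open>One integrable majorant serves all multipliers within distance \<open>D\<close>, so the multiplier may be chosen
    after the output is known.\<close>
  have gap: "\<exists>R. integrable M R \<and> (\<integral>\<omega>. R \<omega> \<partial>M) \<le> rate_bound B G x0 y0 D k \<and>
      (\<forall>\<omega> y. (\<forall>i. 0 \<le> y $ i) \<longrightarrow> (norm (xs - x0))\<^sup>2 + (norm (y - y0))\<^sup>2 \<le> D \<longrightarrow>
        lagrangian f g (xout k \<omega>) y - f xs \<le> R \<omega>)" if k: "1 \<le> k" and D_nonneg: "0 \<le> D" for k D
  proof -
    let ?t = "step_size B" and ?W = "\<Sum>i<k. step_size B i"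
    have W: "0 < ?W" by (rule sum_step_size_pos[OF B k])
    obtain R where R: "integrable M R"
      "(\<integral>\<omega>. R \<omega> \<partial>M) \<le> (3 + ln (real k + 1)) / 2 * D + (\<Sum>i<k. 5 * (?t i)\<^sup>2 * G\<^sup>2)"
      "\<And>\<omega> u. u \<in> primal_dual_set \<Longrightarrow> (norm (u - (x0, y0)))\<^sup>2 \<le> D \<Longrightarrow>
        (\<Sum>i<k. ?t i * (F (z i \<omega>) \<bullet> (z i \<omega> - u))) \<le> R \<omega>"
      using gap_majorant[OF D_nonneg, of k] by blast
    have "(\<integral>\<omega>. R \<omega> / ?W \<partial>M) \<le> rate_bound B G x0 y0 D k"
    proof -
      have "(\<integral>\<omega>. R \<omega> \<partial>M) \<le> (3 + ln (real k + 1)) / 2 * D + (norm x0)\<^sup>2 + (norm y0)\<^sup>2 + (\<Sum>i<k. 5 * (?t i)\<^sup>2 * G\<^sup>2)"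
        using R(2) zero_le_power2[of "norm x0"] zero_le_power2[of "norm y0"] by linarith
      then show ?thesis unfolding rate_bound_def using W by (simp add: divide_right_mono)
    qed
    moreover have "lagrangian f g (xout k \<omega>) y - f xs \<le> R \<omega> / ?W"
      if y: "\<forall>i. 0 \<le> y $ i" and D: "(norm (xs - x0))\<^sup>2 + (norm (y - y0))\<^sup>2 \<le> D" for \<omega> y
    proof -
      have "?W * lagrangian f g (xout k \<omega>) y \<le> (\<Sum>i<k. ?t i * lagrangian f g (fst (z i \<omega>)) y)"
        unfolding xout_def
        by (rule averaged_iterate_jensen[OF convex_on_lagrangian B k]) (use assms y in auto)
      then have "?W * (lagrangian f g (xout k \<omega>) y - f xs)
          \<le> (\<Sum>i<k. ?t i * (lagrangian f g (fst (z i \<omega>)) y - f xs))"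
        by (simp add: right_diff_distrib sum_subtractf sum_distrib_right)
      also have "\<dots> \<le> (\<Sum>i<k. ?t i * (F (z i \<omega>) \<bullet> (z i \<omega> - (xs, y))))"
      proof (intro sum_mono mult_left_mono)
        fix i
        obtain a b where ab: "z i \<omega> = (a, b)" by fastforce
        with z_in_Z[of i \<omega>] have b: "\<And>j. 0 \<le> b $ j" by (simp add: mem_primal_dual_set)
        have "lagrangian f g a y - lagrangian f g xs b \<le> mean_operator P nf ng gt (a, b) \<bullet> ((a, b) - (xs, y))"
          by (rule mean_operator_gap[OF P b]) (use assms in auto)
        then show "lagrangian f g (fst (z i \<omega>)) y - f xs \<le> F (z i \<omega>) \<bullet> (z i \<omega> - (xs, y))"
          using saddle_point_value(2)[OF saddle b] by (simp add: F ab)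
      qed (simp add: step_size_pos[OF B] less_imp_le)
      also have "\<dots> \<le> R \<omega>"
        by (rule R(3)) (use y D in \<open>auto simp: mem_primal_dual_set norm_Pair\<close>)
      finally show ?thesis using W by (simp add: field_simps)
    qed
    ultimately show ?thesis using R(1) by (intro exI[of _ "\<lambda>\<omega>. R \<omega> / ?W"]) auto
  qed

  have xout_measurable[measurable]: "xout k \<in> borel_measurable M" for k
  proof -
    have [measurable]: "(\<lambda>\<omega>. fst (z i \<omega>)) \<in> borel_measurable M" for i
      by (rule measurable_compose[OF z_measurable]) (auto intro!: borel_measurable_continuous_onI continuous_intros)
    show ?thesis unfolding xout_def averaged_iterate_def by measurable
  qed
  have convex_measurable: "h \<in> borel_measurable borel" if "convex_on UNIV h" for h :: "real ^ 'd \<Rightarrow> real"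
    using that by (intro borel_measurable_continuous_onI convex_on_continuous) auto
  have [measurable]: "f \<in> borel_measurable borel" "g i \<in> borel_measurable borel" for i
    using assms by (auto intro: convex_measurable)

  have objective: "integrable M (\<lambda>\<omega>. \<bar>f (xout k \<omega>) - f xs\<bar>) \<and>
      (\<integral>\<omega>. \<bar>f (xout k \<omega>) - f xs\<bar> \<partial>M) \<le> rate_bound B G x0 y0 D1 k" if k: "1 \<le> k" for k
  proof -
    obtain R where R: "integrable M R" "(\<integral>\<omega>. R \<omega> \<partial>M) \<le> rate_bound B G x0 y0 D1 k"
      "\<And>\<omega> y. (\<And>i. 0 \<le> y $ i) \<Longrightarrow> (norm (xs - x0))\<^sup>2 + (norm (y - y0))\<^sup>2 \<le> D1 \<Longrightarrow>
        lagrangian f g (xout k \<omega>) y - f xs \<le> R \<omega>"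
      using gap[OF k D_nonneg(1)] by blast
    have le: "\<bar>f (xout k \<omega>) - f xs\<bar> \<le> R \<omega>" for \<omega>
    proof (rule objective_error_le_gap[OF saddle], rule R(3))
      fix y assume y: "y \<in> {0, 2 *\<^sub>R ys}"
      then show "0 \<le> y $ i" for i using ys by auto
      from y consider "y = 0" | "y = 2 *\<^sub>R ys" by blast
      then have "(norm (y - y0))\<^sup>2 \<le> 2 * ((norm (ys - y0))\<^sup>2 + (norm ys)\<^sup>2) + (norm y0)\<^sup>2"
      proof cases
        case 2
        then show ?thesis using norm_doubled_dual_le[of ys y0] by (simp only: add_increasing2 zero_le_power2)
      qed simp
      then show "(norm (xs - x0))\<^sup>2 + (norm (y - y0))\<^sup>2 \<le> D1" by (simp add: D1_def)
    qed
    have int: "integrable M (\<lambda>\<omega>. \<bar>f (xout k \<omega>) - f xs\<bar>)"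
      by (rule Bochner_Integration.integrable_bound[OF R(1)]) (use le in \<open>auto intro: order_trans[OF _ abs_ge_self]\<close>)
    with integral_mono[OF int R(1) le] R(2) show ?thesis by simp
  qed

  have feasibility: "(\<forall>i. integrable M (\<lambda>\<omega>. max 0 (g i (xout k \<omega>)))) \<and>
      (\<Sum>i\<in>UNIV. \<integral>\<omega>. max 0 (g i (xout k \<omega>)) \<partial>M) \<le> rate_bound B G x0 y0 D2 k" if k: "1 \<le> k" for k
  proof -
    obtain R where R: "integrable M R" "(\<integral>\<omega>. R \<omega> \<partial>M) \<le> rate_bound B G x0 y0 D2 k"
      "\<And>\<omega> y. (\<And>i. 0 \<le> y $ i) \<Longrightarrow> (norm (xs - x0))\<^sup>2 + (norm (y - y0))\<^sup>2 \<le> D2 \<Longrightarrow>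
        lagrangian f g (xout k \<omega>) y - f xs \<le> R \<omega>"
      using gap[OF k D_nonneg(2)] by blast
    have le: "(\<Sum>i\<in>UNIV. max 0 (g i (xout k \<omega>))) \<le> R \<omega>" for \<omega>
    proof (rule constraint_violation_le_gap[OF saddle], rule R(3))
      show "0 \<le> (ys + (\<chi> i. if 0 < g i (xout k \<omega>) then 1 else 0)) $ i" for i
        using ys by simp
      show "(norm (xs - x0))\<^sup>2 + (norm (ys + (\<chi> i. if 0 < g i (xout k \<omega>) then 1 else 0) - y0))\<^sup>2 \<le> D2"
        using norm_indicator_dual_le[OF ys y0] by (simp add: D2_def add.assoc)
    qed
    have int: "integrable M (\<lambda>\<omega>. max 0 (g i (xout k \<omega>)))" for i
    proof (rule Bochner_Integration.integrable_bound[OF R(1)])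
      have "max 0 (g i (xout k \<omega>)) \<le> R \<omega>" for \<omega>
        by (rule order_trans[OF member_le_sum[of i UNIV] le]) auto
      then show "AE \<omega> in M. norm (max 0 (g i (xout k \<omega>))) \<le> norm (R \<omega>)"
        by (auto intro: order_trans[OF _ abs_ge_self])
    qed simp
    have "(\<Sum>i\<in>UNIV. \<integral>\<omega>. max 0 (g i (xout k \<omega>)) \<partial>M) = (\<integral>\<omega>. (\<Sum>i\<in>UNIV. max 0 (g i (xout k \<omega>))) \<partial>M)"
      using int by simp
    also have "\<dots> \<le> (\<integral>\<omega>. R \<omega> \<partial>M)"
      by (rule integral_mono) (use int R(1) le in auto)
    finally show ?thesis using int R(2) by simp
  qed

  have "rate_bound B G x0 y0 D1 \<in> soft_bigo (\<lambda>k. 1 / sqrt (real k))"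
    "rate_bound B G x0 y0 D2 \<in> soft_bigo (\<lambda>k. 1 / sqrt (real k))"
    by (auto intro!: rate_bound_soft_bigo B D_nonneg)
  with objective feasibility show ?thesis by blast
qed

end
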